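(* Let $N\ge 2$, $d\ge 1$, $w>0$, $\beta>0$, $t>0$. Let $V:\mathbb{R}^d\to\mathbb{R}$ be smooth and let $U(x)=u(|x|)$ be a (possibly singular at the origin) radial interaction kernel on $\mathbb{R}^d$, split as $U=U_1+U_2$ with $U_k(x)=u_k(|x|)$ ($k=1,2$), where $U_1$ is smooth and bounded, and $U_2$ is compactly supported and possibly singular at the origin. Let $$\pi(\boldsymbol{X})\propto\exp\Big[-\beta\Big(\sum_{i=1}^N wV(x_i)+\sum_{1\le i<j\le N}w^2U(x_i-x_j)\Big)\Big],\qquad \boldsymbol{X}=(x_1,\dots,x_N)\in\mathbb{R}^{Nd}.$$ Let $T(\boldsymbol{X},\boldsymbol{X}^* )$ be the transition probability density of the splitting Monte Carlo Markov chain whose single move from $\boldsymbol{X}=(x_1,\dots,x_N)$ consists of the following three steps: Step 1. Choose $i\in\{1,\dots,N\}$ uniformly at random. Step 2. With $x_j$, $j\ne i$, held fixed, solve on $[0,t]$ the SDE $$dX^i=-\Big(\frac{\nabla V(X^i)}{w(N-1)}+\frac{1}{N-1}\sum_{j\ne i}\nabla U_1(X^i-x_j)\Big)\,ds+\sqrt{\frac{2}{(N-1)w^2\beta}}\,dW^i,\qquad X^i(0)=x_i,$$ where $W^i$ is a standard $d$-dimensional Brownian motion, and set $x_i^*=X^i(t)$. Step 3. With probability $$acc(x_i,x_i^* )=\min\Big\{1,\exp\Big[-\beta\sum_{j\neq i}w^2\big(U_2(x_i^*-x_j)-U_2(x_i-x_j)\big)\Big]\Big\}$$ replace $x_i$ by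 $x_i^*$; otherwise leave $x_i$ unchanged. Then the chain satisfies the detailed balance condition $$\pi(\boldsymbol{X})\,T(\boldsymbol{X},\boldsymbol{X}^* )=\pi(\boldsymbol{X}^* )\,T(\boldsymbol{X}^*,\boldsymbol{X})$$ for all states $\boldsymbol{X},\boldsymbol{X}^*$.
   Context: Since each move updates only one particle, $T(\boldsymbol{X},\boldsymbol{X}^* )$ is zero unless $\boldsymbol{X}$ and $\boldsymbol{X}^*$ differ in at most one component. If they differ exactly in the $i$-th component ($x_i\ne x_i^*$), then $T(\boldsymbol{X},\boldsymbol{X}^* )$ denotes the density, with respect to Lebesgue measure in the updated component $x_i^*\in\mathbb{R}^d$, of moving from $\boldsymbol{X}$ to $\boldsymbol{X}^*$ in one move (Steps 1--3, including acceptance). For $\boldsymbol{X}=\boldsymbol{X}^*$ the identity is trivial. Let $p(z,t;x_i)$ denote the transition density at time $t$ of the SDE in Step 2 started at $x_i$, with the other particles $x_j$, $j\ne i$, fixed. The SDE is understood to be well posed with such a density, $\pi$ is understood to be normalizable, and when the kernel is singular at the origin, states are configurations of pairwise distinct points.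
   Formalization: The transition density p(z,t;x_i) is taken to be the version jointly continuous in the start point x_i and the end point z; a density is otherwise fixed only almost everywhere, and the identity for all states would fail for arbitrary versions. *)

theory Defs
  imports "HOL-Probability.Probability"
begin

subsection \<open>Smooth functions and gradients\<close>

fun Ck :: "nat \<Rightarrow> ('a::euclidean_space \<Rightarrow> real) \<Rightarrow> bool" where
  "Ck 0 f \<longleftrightarrow> continuous_on UNIV f"
| "Ck (Suc k) f \<longleftrightarrow> f differentiable_on UNIV \<and> (\<forall>v. Ck k (\<lambda>x. frechet_derivative f (at x) v))"

definition smooth :: "('a::euclidean_space \<Rightarrow> real) \<Rightarrow> bool" where
  "smooth f \<longleftrightarrow> (\<forall>k. Ck k f)"

definition gradient :: "('a::euclidean_space \<Rightarrow> real) \<Rightarrow> 'a \<Rightarrow> 'a" where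
  "gradient f x = (THE D. GDERIV f x :> D)"

subsection \<open>Brownian motion and stochastic differential equations with additive noise\<close>

text \<open>Standard Brownian motion in a Euclidean space, indexed by the nonnegative reals.\<close>

definition brownian_motion :: "'w measure \<Rightarrow> (real \<Rightarrow> 'w \<Rightarrow> 'a::euclidean_space) \<Rightarrow> bool" where
  "brownian_motion M W \<longleftrightarrow>
     prob_space M \<and>
     (\<forall>s\<ge>0. W s \<in> borel_measurable M) \<and>
     (AE \<omega> in M. W 0 \<omega> = 0) \<and>
     (AE \<omega> in M. continuous_on {0..} (\<lambda>s. W s \<omega>)) \<and>
     (\<forall>r s. 0 \<le> r \<longrightarrow> r < s \<longrightarrow>
        distr M borel (\<lambda>\<omega>. W s \<omega> - W r \<omega>) =
        density lborel (\<lambda>x. ennreal (\<Prod>e\<in>Basis. normal_density 0 (sqrt (s - r)) (x \<bullet> e)))) \<and>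
     (\<forall>n \<tau>. 0 \<le> \<tau> 0 \<longrightarrow> mono \<tau> \<longrightarrow>
        prob_space.indep_vars M (\<lambda>_. borel)
          (\<lambda>k \<omega>. W (\<tau> (Suc k)) \<omega> - W (\<tau> k) \<omega>) {..<n::nat})"

text \<open>
  A solution on \<open>[0, t]\<close> of \<open>dY = b(Y) ds + \<sigma> dW\<close>, \<open>Y(0) = x\<close>, with a constant \<open>\<sigma>\<close>.
  Since the noise is additive, the stochastic integral of the constant \<open>\<sigma>\<close> is \<open>\<sigma> W(s)\<close>
  and the equation is the pathwise integral equation
  \<open>Y(s) = x + \<integral>\<^sub>0\<^sup>s b(Y(r)) dr + \<sigma> W(s)\<close>.
\<close>

definition sde_solution ::
  "'w measure \<Rightarrow> ('a::euclidean_space \<Rightarrow> 'a) \<Rightarrow> real \<Rightarrow> real \<Rightarrow> 'a \<Rightarrow>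
   (real \<Rightarrow> 'w \<Rightarrow> 'a) \<Rightarrow> (real \<Rightarrow> 'w \<Rightarrow> 'a) \<Rightarrow> bool" where
  "sde_solution M b \<sigma> t x W Y \<longleftrightarrow>
     (\<forall>s\<in>{0..t}. Y s \<in> borel_measurable M) \<and>
     (AE \<omega> in M. continuous_on {0..t} (\<lambda>s. Y s \<omega>) \<and>
        (\<forall>s\<in>{0..t}. ((\<lambda>r. b (Y r \<omega>)) has_integral (Y s \<omega> - x - \<sigma> *\<^sub>R W s \<omega>)) {0..s}))"

text \<open>
  The equation \<open>dY = b(Y) ds + \<sigma> dW\<close> is well posed on \<open>[0, t]\<close> for every initial point \<open>x\<close>
  (a solution exists, and its law at time \<open>t\<close> is unique), and that law has the Lebesgue
  density \<open>q x\<close>. This determines \<open>q x\<close> only almost everywhere; pointwise identities need a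
  choice of version, namely the continuous one.
\<close>

definition sde_transition_density ::
  "'w measure \<Rightarrow> ('a::euclidean_space \<Rightarrow> 'a) \<Rightarrow> real \<Rightarrow> real \<Rightarrow> ('a \<Rightarrow> 'a \<Rightarrow> real) \<Rightarrow> bool" where
  "sde_transition_density M b \<sigma> t q \<longleftrightarrow>
     (\<forall>x. q x \<in> borel_measurable borel \<and> (\<forall>z. 0 \<le> q x z) \<and>
        (\<exists>W Y. brownian_motion M W \<and> sde_solution M b \<sigma> t x W Y) \<and>
        (\<forall>W Y. brownian_motion M W \<longrightarrow> sde_solution M b \<sigma> t x W Y \<longrightarrow>
           distr M borel (Y t) = density lborel (\<lambda>z. ennreal (q x z))))"

subsection \<open>Configurations and the Gibbs density\<close>

text \<open>
  The particles are indexed by \<open>{1..N}\<close>; a point of \<open>\<real>\<^sup>N\<^sup>d\<close> is an extensional function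
  on this index set, so that Lebesgue measure on it is the finite product of \<open>lborel\<close>.
\<close>

abbreviation configs :: "nat \<Rightarrow> (nat \<Rightarrow> 'a::euclidean_space) set" where
  "configs N \<equiv> {1..N} \<rightarrow>\<^sub>E UNIV"

text \<open>
  A kernel is singular at the origin if it is not continuous there; the real number
  \<open>U 0\<close> is then only a placeholder, and states are collision free.
\<close>

definition states :: "nat \<Rightarrow> ('a::euclidean_space \<Rightarrow> real) \<Rightarrow> (nat \<Rightarrow> 'a) set" where
  "states N U = {X \<in> configs N. \<not> isCont U 0 \<longrightarrow> inj_on X {1..N}}"

definition gibbs_weight ::
  "nat \<Rightarrow> real \<Rightarrow> real \<Rightarrow> ('a::euclidean_space \<Rightarrow> real) \<Rightarrow> ('a \<Rightarrow> real) \<Rightarrow> (nat \<Rightarrow> 'a) \<Rightarrow> real" where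
  "gibbs_weight N w \<beta> V U X =
     exp (- \<beta> * ((\<Sum>i=1..N. w * V (X i)) + (\<Sum>i=1..N. \<Sum>j\<in>{i<..N}. w\<^sup>2 * U (X i - X j))))"

definition normalizable ::
  "nat \<Rightarrow> real \<Rightarrow> real \<Rightarrow> ('a::euclidean_space \<Rightarrow> real) \<Rightarrow> ('a \<Rightarrow> real) \<Rightarrow> bool" where
  "normalizable N w \<beta> V U \<longleftrightarrow> integrable (Pi\<^sub>M {1..N} (\<lambda>_. lborel)) (gibbs_weight N w \<beta> V U)"

definition gibbs_density ::
  "nat \<Rightarrow> real \<Rightarrow> real \<Rightarrow> ('a::euclidean_space \<Rightarrow> real) \<Rightarrow> ('a \<Rightarrow> real) \<Rightarrow> (nat \<Rightarrow> 'a) \<Rightarrow> real" where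
  "gibbs_density N w \<beta> V U X =
     gibbs_weight N w \<beta> V U X / (LINT Y|Pi\<^sub>M {1..N} (\<lambda>_. lborel). gibbs_weight N w \<beta> V U Y)"

subsection \<open>The splitting Monte Carlo chain\<close>

definition drift ::
  "nat \<Rightarrow> real \<Rightarrow> ('a::euclidean_space \<Rightarrow> real) \<Rightarrow> ('a \<Rightarrow> real) \<Rightarrow> nat \<Rightarrow> (nat \<Rightarrow> 'a) \<Rightarrow> 'a \<Rightarrow> 'a" where
  "drift N w V U\<^sub>1 i X y =
     - ((1 / (w * (real N - 1))) *\<^sub>R gradient V y +
        (1 / (real N - 1)) *\<^sub>R (\<Sum>j\<in>{1..N} - {i}. gradient U\<^sub>1 (y - X j)))"

definition noise :: "nat \<Rightarrow> real \<Rightarrow> real \<Rightarrow> real" where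
  "noise N w \<beta> = sqrt (2 / ((real N - 1) * w\<^sup>2 * \<beta>))"

definition acc ::
  "nat \<Rightarrow> real \<Rightarrow> real \<Rightarrow> ('a::euclidean_space \<Rightarrow> real) \<Rightarrow> nat \<Rightarrow> (nat \<Rightarrow> 'a) \<Rightarrow> 'a \<Rightarrow> real" where
  "acc N w \<beta> U\<^sub>2 i X z =
     min 1 (exp (- \<beta> * (\<Sum>j\<in>{1..N} - {i}. w\<^sup>2 * (U\<^sub>2 (z - X j) - U\<^sub>2 (X i - X j)))))"

text \<open>
  \<open>p i X z\<close> is the density at \<open>z\<close> of the proposal for particle \<open>i\<close> out of \<open>X\<close>.
  The law of one move out of \<open>X\<close> selects \<open>i\<close> uniformly, proposes \<open>z\<close>, and accepts or rejects:
\<close>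

definition move_law ::
  "nat \<Rightarrow> real \<Rightarrow> real \<Rightarrow> ('a::euclidean_space \<Rightarrow> real) \<Rightarrow> (nat \<Rightarrow> (nat \<Rightarrow> 'a) \<Rightarrow> 'a \<Rightarrow> real) \<Rightarrow>
   (nat \<Rightarrow> 'a) \<Rightarrow> (nat \<Rightarrow> 'a) measure" where
  "move_law N w \<beta> U\<^sub>2 p X =
     uniform_count_measure {1..N} \<bind> (\<lambda>i.
     density lborel (\<lambda>z. ennreal (p i X z)) \<bind> (\<lambda>z.
     measure_pmf (bernoulli_pmf (acc N w \<beta> U\<^sub>2 i X z)) \<bind> (\<lambda>accepted.
     return (Pi\<^sub>M {1..N} (\<lambda>_. lborel)) (if accepted then X(i := z) else X))))"

text \<open>
  The transition density of the chain. If \<open>X\<close> and \<open>X'\<close> differ exactly in component \<open>i\<close>, it is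
  the Lebesgue density in that component; on the diagonal it is the probability that the
  proposal is rejected. The lemmas \<open>emeasure_move_law_update\<close> and \<open>emeasure_move_law_stay\<close>
  derive these values from \<^const>\<open>move_law\<close>.
\<close>

definition transition ::
  "nat \<Rightarrow> real \<Rightarrow> real \<Rightarrow> ('a::euclidean_space \<Rightarrow> real) \<Rightarrow> (nat \<Rightarrow> (nat \<Rightarrow> 'a) \<Rightarrow> 'a \<Rightarrow> real) \<Rightarrow>
   (nat \<Rightarrow> 'a) \<Rightarrow> (nat \<Rightarrow> 'a) \<Rightarrow> real" where
  "transition N w \<beta> U\<^sub>2 p X X' =
     (let D = {i\<in>{1..N}. X i \<noteq> X' i} in
      if D = {} then
        (\<Sum>i=1..N. 1 / real N * (LINT z|lborel. p i X z * (1 - acc N w \<beta> U\<^sub>2 i X z)))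
      else if \<exists>i. D = {i} then
        (let i = the_elem D in 1 / real N * p i X (X' i) * acc N w \<beta> U\<^sub>2 i X (X' i))
      else 0)"

lemma acc_nonneg: "0 \<le> acc N w \<beta> U i X z" and acc_le_1: "acc N w \<beta> U i X z \<le> 1"
  by (auto simp: acc_def)

lemma borel_measurable_acc:
  fixes U :: "'a::euclidean_space \<Rightarrow> real"
  assumes [measurable]: "U \<in> borel_measurable borel"
  shows "acc N w \<beta> U i X \<in> borel_measurable borel"
  unfolding acc_def[abs_def] by measurable

lemma measurable_update_config:
  fixes X :: "nat \<Rightarrow> 'a::euclidean_space"
  assumes "X \<in> configs N" "i \<in> {1..N}"
  shows "(\<lambda>z. X(i := z)) \<in> measurable borel (Pi\<^sub>M {1..N} (\<lambda>_. lborel))"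
proof (rule measurable_PiM_single')
  fix j assume "j \<in> {1..N}"
  show "(\<lambda>z. (X(i := z)) j) \<in> measurable borel (lborel :: 'a measure)"
    by (cases "j = i") auto
next
  show "(\<lambda>z. X(i := z)) \<in> space borel \<rightarrow> (\<Pi>\<^sub>E j\<in>{1..N}. space (lborel :: 'a measure))"
    using assms by (auto simp: PiE_def extensional_def)
qed

lemma emeasure_move_law:
  fixes X :: "nat \<Rightarrow> 'a::euclidean_space"
  assumes N: "N \<ge> 1" and X: "X \<in> configs N" and U: "U \<in> borel_measurable borel"
    and p: "\<And>i. i \<in> {1..N} \<Longrightarrow> p i X \<in> borel_measurable borel"
           "\<And>i. i \<in> {1..N} \<Longrightarrow> prob_space (density lborel (\<lambda>z. ennreal (p i X z)))"
    and S: "S \<in> sets (Pi\<^sub>M {1..N} (\<lambda>_. lborel))"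
  shows "emeasure (move_law N w \<beta> U p X) S =
    (\<Sum>i=1..N. ennreal (1 / real N) *
      (\<integral>\<^sup>+z. ennreal (p i X z) * (ennreal (acc N w \<beta> U i X z) * indicator S (X(i := z)) +
         ennreal (1 - acc N w \<beta> U i X z) * indicator S X) \<partial>lborel))"
proof -
  let ?P = "Pi\<^sub>M {1..N} (\<lambda>_. lborel :: 'a measure)"
  let ?a = "acc N w \<beta> U"
  define R where "R i z = measure_pmf (bernoulli_pmf (?a i X z)) \<bind>
     (\<lambda>b. return ?P (if b then X(i := z) else X))" for i z
  define K where "K i = density lborel (\<lambda>z. ennreal (p i X z)) \<bind> R i" for i
  have XP: "X \<in> space ?P" using X by (simp add: space_PiM)
  have upd: "X(i := z) \<in> space ?P" if "i \<in> {1..N}" for i z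
    using measurable_space[OF measurable_update_config[OF X that], of z] by simp
  have Rm: "(\<lambda>b. return ?P (if b then X(i := z) else X))
      \<in> measurable (measure_pmf q) (subprob_algebra ?P)" if "i \<in> {1..N}" for i z q
    using upd[OF that] XP
    by (auto simp: measurable_def space_subprob_algebra intro!: prob_space_imp_subprob_space prob_space_return)
  have eR: "emeasure (R i z) S' = ennreal (?a i X z) * indicator S' (X(i := z)) +
         ennreal (1 - ?a i X z) * indicator S' X"
    if i: "i \<in> {1..N}" and S': "S' \<in> sets ?P" for i z S'
    unfolding R_def
    using S' acc_nonneg[of N w \<beta> U i X z] acc_le_1[of N w \<beta> U i X z]
    by (subst emeasure_bind[OF _ Rm[OF i] S']) (auto simp: mult_ac)
  have psR: "prob_space (R i z)" if "i \<in> {1..N}" for i z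
    unfolding R_def using upd[OF that] XP
    by (intro prob_space.prob_space_bind[OF prob_space_measure_pmf _ Rm[OF that]])
       (auto intro!: AE_I2 prob_space_return)
  have setsR: "sets (R i z) = sets ?P" if "i \<in> {1..N}" for i z
    unfolding R_def by (rule sets_bind) auto
  have RK: "R i \<in> measurable (density lborel (\<lambda>z. ennreal (p i X z))) (subprob_algebra ?P)"
    if i: "i \<in> {1..N}" for i
  proof (rule measurable_subprob_algebra)
    show "subprob_space (R i z)" for z
      using psR[OF i] by (rule prob_space_imp_subprob_space)
    show "sets (R i z) = sets ?P" for z by (rule setsR[OF i])
    fix S' assume S': "S' \<in> sets ?P"
    have [measurable]: "?a i X \<in> borel_measurable borel"
      "(\<lambda>z. X(i := z)) \<in> measurable borel ?P" "S' \<in> sets ?P"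
      using borel_measurable_acc[OF U] measurable_update_config[OF X i] S' by auto
    have "(\<lambda>z. emeasure (R i z) S') \<in> borel_measurable borel"
      unfolding eR[OF i S'] by measurable
    then show "(\<lambda>z. emeasure (R i z) S') \<in> borel_measurable (density lborel (\<lambda>z. ennreal (p i X z)))"
      by simp
  qed
  have eK: "emeasure (K i) S = (\<integral>\<^sup>+z. ennreal (p i X z) * (ennreal (?a i X z) * indicator S (X(i := z)) +
         ennreal (1 - ?a i X z) * indicator S X) \<partial>lborel)" if i: "i \<in> {1..N}" for i
  proof -
    have [measurable]: "?a i X \<in> borel_measurable borel" "p i X \<in> borel_measurable borel"
      "(\<lambda>z. X(i := z)) \<in> measurable borel ?P" "S \<in> sets ?P"
      using borel_measurable_acc[OF U] measurable_update_config[OF X i] S p(1)[OF i] by auto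
    show ?thesis
      unfolding K_def
      by (subst emeasure_bind[OF _ RK[OF i] S])
         (simp_all add: eR[OF i S] nn_integral_density)
  qed
  have psK: "prob_space (K i)" if "i \<in> {1..N}" for i
    unfolding K_def using psR[OF that]
    by (intro prob_space.prob_space_bind[OF p(2)[OF that] _ RK[OF that]]) (auto intro!: AE_I2)
  have setsK: "sets (K i) = sets ?P" if "i \<in> {1..N}" for i
    unfolding K_def using setsR[OF that] by (intro sets_bind) auto
  have Km: "K \<in> measurable (uniform_count_measure {1..N}) (subprob_algebra ?P)"
    using psK setsK
    by (auto simp: measurable_def space_subprob_algebra space_uniform_count_measure
        sets_uniform_count_measure intro: prob_space_imp_subprob_space)
  have "move_law N w \<beta> U p X = uniform_count_measure {1..N} \<bind> K"
    by (simp add: move_law_def K_def[abs_def] R_def[abs_def])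
  also have "emeasure \<dots> S = (\<integral>\<^sup>+i. emeasure (K i) S \<partial>uniform_count_measure {1..N})"
    using N by (intro emeasure_bind[OF _ Km S]) (auto simp: space_uniform_count_measure)
  also have "\<dots> = (\<Sum>i=1..N. ennreal (1 / real N) * emeasure (K i) S)"
    unfolding uniform_count_measure_def
    by (subst nn_integral_point_measure_finite) (auto simp: mult_ac)
  finally show ?thesis using eK by simp
qed

lemma emeasure_move_law_update:
  fixes X :: "nat \<Rightarrow> 'a::euclidean_space"
  assumes N: "N \<ge> 1" and X: "X \<in> configs N" and U: "U \<in> borel_measurable borel"
    and p: "\<And>i. i \<in> {1..N} \<Longrightarrow> p i X \<in> borel_measurable borel" "\<And>i z. 0 \<le> p i X z"
           "\<And>i. i \<in> {1..N} \<Longrightarrow> prob_space (density lborel (\<lambda>z. ennreal (p i X z)))"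
    and i: "i \<in> {1..N}" and A: "A \<in> sets borel" "X i \<notin> A"
  shows "emeasure (move_law N w \<beta> U p X) ((\<lambda>z. X(i := z)) ` A) =
    (\<integral>\<^sup>+z\<in>A. ennreal (transition N w \<beta> U p X (X(i := z))) \<partial>lborel)"
proof -
  let ?S = "(\<lambda>z. X(i := z)) ` A"
  have "?S = (\<Pi>\<^sub>E j\<in>{1..N}. if j = i then A else {X j})"
  proof (intro set_eqI iffI)
    fix Y assume "Y \<in> (\<Pi>\<^sub>E j\<in>{1..N}. if j = i then A else {X j})"
    then have Y: "Y i \<in> A" "\<And>j. j \<in> {1..N} \<Longrightarrow> j \<noteq> i \<Longrightarrow> Y j = X j" "Y \<in> extensional {1..N}"
      using i by (auto simp: PiE_iff split: if_splits)
    have "Y = X(i := Y i)"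
    proof
      fix k show "Y k = (X(i := Y i)) k"
        using Y X by (cases "k \<in> {1..N}"; cases "k = i") (auto simp: PiE_def extensional_def)
    qed
    with Y(1) show "Y \<in> ?S" by blast
  qed (use X i in \<open>auto simp: PiE_iff extensional_def\<close>)
  also have "\<dots> \<in> sets (Pi\<^sub>M {1..N} (\<lambda>_. lborel))"
    using A by (intro sets_PiM_I_finite) auto
  finally have S: "?S \<in> sets (Pi\<^sub>M {1..N} (\<lambda>_. lborel))" .
  have XS: "X \<notin> ?S" using A(2) by (metis fun_upd_same imageE)
  have updi: "X(i := z) \<in> ?S \<longleftrightarrow> z \<in> A" for z
    by (metis (no_types, lifting) fun_upd_same image_iff)
  have updk: "X(k := z) \<notin> ?S" if "k \<noteq> i" for k z
    using A(2) that by (metis (no_types, lifting) fun_upd_def image_iff)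
  let ?F = "\<lambda>k. ennreal (1 / real N) *
      (\<integral>\<^sup>+z. ennreal (p k X z) * (ennreal (acc N w \<beta> U k X z) * indicator ?S (X(k := z)) +
         ennreal (1 - acc N w \<beta> U k X z) * indicator ?S X) \<partial>lborel)"
  have "emeasure (move_law N w \<beta> U p X) ?S = (\<Sum>k=1..N. ?F k)"
    using N X U p(1,3) S by (rule emeasure_move_law)
  also have "\<dots> = (\<Sum>k\<in>{i}. ?F k)"
    using i XS updk by (intro sum.mono_neutral_right) auto
  also have "\<dots> = ennreal (1 / real N) *
      (\<integral>\<^sup>+z. ennreal (p i X z) * (ennreal (acc N w \<beta> U i X z) * indicator A z) \<partial>lborel)"
    using XS updi by (simp add: indicator_def)
  also have "\<dots> = (\<integral>\<^sup>+z. ennreal (1 / real N) *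
      (ennreal (p i X z) * (ennreal (acc N w \<beta> U i X z) * indicator A z)) \<partial>lborel)"
  proof -
    have [measurable]: "acc N w \<beta> U i X \<in> borel_measurable borel" "p i X \<in> borel_measurable borel"
      "A \<in> sets borel"
      using borel_measurable_acc[OF U] p(1)[OF i] A by auto
    show ?thesis by (rule nn_integral_cmult[symmetric]) measurable
  qed
  also have "\<dots> = (\<integral>\<^sup>+z\<in>A. ennreal (transition N w \<beta> U p X (X(i := z))) \<partial>lborel)"
  proof (rule nn_integral_cong)
    fix z
    have "{k \<in> {1..N}. X k \<noteq> (X(i := z)) k} = {i}" if "z \<in> A"
      using i A(2) that by auto
    then show "ennreal (1 / real N) * (ennreal (p i X z) * (ennreal (acc N w \<beta> U i X z) * indicator A z))
        = ennreal (transition N w \<beta> U p X (X(i := z))) * indicator A z"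
      using p(2)[of i z] acc_nonneg[of N w \<beta> U i X z]
      by (cases "z \<in> A") (simp_all add: transition_def Let_def mult.assoc
          flip: ennreal_mult)
  qed
  finally show ?thesis .
qed

lemma emeasure_move_law_stay:
  fixes X :: "nat \<Rightarrow> 'a::euclidean_space"
  assumes N: "N \<ge> 1" and X: "X \<in> configs N" and U: "U \<in> borel_measurable borel"
    and p: "\<And>i. i \<in> {1..N} \<Longrightarrow> p i X \<in> borel_measurable borel" "\<And>i z. 0 \<le> p i X z"
           "\<And>i. i \<in> {1..N} \<Longrightarrow> prob_space (density lborel (\<lambda>z. ennreal (p i X z)))"
  shows "emeasure (move_law N w \<beta> U p X) {X} = ennreal (transition N w \<beta> U p X X)"
proof -
  have "{X} = (\<Pi>\<^sub>E j\<in>{1..N}. {X j})"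
    using PiE_singleton[of X "{1..N}"] X by (auto simp: PiE_def)
  also have "\<dots> \<in> sets (Pi\<^sub>M {1..N} (\<lambda>_. lborel))"
    by (intro sets_PiM_I_finite) auto
  finally have S: "{X} \<in> sets (Pi\<^sub>M {1..N} (\<lambda>_. lborel))" .
  have int: "(\<integral>\<^sup>+z. ennreal (p i X z) * (ennreal (acc N w \<beta> U i X z) * indicator {X} (X(i := z)) +
         ennreal (1 - acc N w \<beta> U i X z) * indicator {X} X) \<partial>lborel) =
       ennreal (LINT z|lborel. p i X z * (1 - acc N w \<beta> U i X z))" if i: "i \<in> {1..N}" for i
  proof -
    have [measurable]: "acc N w \<beta> U i X \<in> borel_measurable borel" "p i X \<in> borel_measurable borel"
      using borel_measurable_acc[OF U] p(1)[OF i] by auto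
    have nn: "0 \<le> p i X z * (1 - acc N w \<beta> U i X z)" for z
      using p(2)[of i z] acc_le_1[of N w \<beta> U i X z] by simp
    have "(\<integral>\<^sup>+z. ennreal (p i X z) \<partial>lborel) = 1"
      using prob_space.emeasure_space_1[OF p(3)[OF i]] by (simp add: emeasure_density)
    then have ip: "integrable lborel (p i X)"
      using p(2) by (intro integrableI_nonneg) auto
    have "integrable lborel (\<lambda>z. p i X z * (1 - acc N w \<beta> U i X z))"
    proof (rule Bochner_Integration.integrable_bound[OF ip])
      show "AE z in lborel. norm (p i X z * (1 - acc N w \<beta> U i X z)) \<le> norm (p i X z)"
        using p(2) acc_nonneg[of N w \<beta> U i X] acc_le_1[of N w \<beta> U i X]
        by (intro AE_I2) (simp add: abs_mult abs_of_nonneg mult_left_le)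
    qed measurable
    then have "(\<integral>\<^sup>+z. ennreal (p i X z * (1 - acc N w \<beta> U i X z)) \<partial>lborel) =
        ennreal (LINT z|lborel. p i X z * (1 - acc N w \<beta> U i X z))"
      using nn by (intro nn_integral_eq_integral) auto
    moreover have "AE z in lborel. z \<noteq> X i" by (rule AE_lborel_singleton)
    then have "(\<integral>\<^sup>+z. ennreal (p i X z) * (ennreal (acc N w \<beta> U i X z) * indicator {X} (X(i := z)) +
         ennreal (1 - acc N w \<beta> U i X z) * indicator {X} X) \<partial>lborel) =
        (\<integral>\<^sup>+z. ennreal (p i X z * (1 - acc N w \<beta> U i X z)) \<partial>lborel)"
    proof (intro nn_integral_cong_AE, eventually_elim)
      case (elim z)
      then have "X(i := z) \<noteq> X" by (metis fun_upd_same)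
      then show ?case
        using p(2)[of i z] acc_le_1[of N w \<beta> U i X z] by (simp add: ennreal_mult)
    qed
    ultimately show ?thesis by simp
  qed
  have nnI: "0 \<le> (LINT z|lborel. p i X z * (1 - acc N w \<beta> U i X z))" for i
    using p(2) by (intro integral_nonneg_AE AE_I2) (simp add: acc_le_1)
  have "emeasure (move_law N w \<beta> U p X) {X} = (\<Sum>i=1..N. ennreal (1 / real N) *
       ennreal (LINT z|lborel. p i X z * (1 - acc N w \<beta> U i X z)))"
    using emeasure_move_law[where p = p, OF N X U p(1,3) S]
    by (simp only: int cong: sum.cong)
  also have "\<dots> = (\<Sum>i=1..N. ennreal (1 / real N * (LINT z|lborel. p i X z * (1 - acc N w \<beta> U i X z))))"
    using nnI by (intro sum.cong refl ennreal_mult[symmetric]) auto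
  also have "\<dots> = ennreal (\<Sum>i=1..N. 1 / real N * (LINT z|lborel. p i X z * (1 - acc N w \<beta> U i X z)))"
    using nnI by (intro sum_ennreal) auto
  also have "\<dots> = ennreal (transition N w \<beta> U p X X)"
    by (simp add: transition_def)
  finally show ?thesis .
qed

end

theory Submission
  imports Defs
begin

text \<open>
  Up to the Metropolis factor for \<open>U\<^sub>2\<close>, detailed balance says that the time-\<open>t\<close> density \<open>q\<close> of
  \<open>dY = - G(Y) ds + \<sigma> dW\<close>, \<open>G = \<nabla>\<Phi>\<close>, is symmetric with respect to \<open>exp (- 2 \<Phi> / \<sigma>\<^sup>2)\<close>. No
  stochastic calculus is needed: the Euler scheme with step \<open>h\<close> has an explicit Gaussian density
  whose defect of reversibility is of order \<open>\<bar>y - x\<bar>\<^sup>3 + h \<bar>y - x\<bar>\<close>, hence of order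
  \<open>h\<^sup>3\<^sup>/\<^sup>2\<close> per step, and \<open>h\<^sup>1\<^sup>/\<^sup>2\<close> in total. Weighting each step with its Metropolis
  acceptance probability, and with the indicator of a large ball, gives an exactly symmetric
  sub-Markov kernel, whose powers are symmetric as well. Since the noise is additive, the Euler
  chain converges pathwise to the given solution, which is bounded on \<open>[0, t]\<close> by continuity, so
  that non-explosion needs no separate argument; the weights tend to 1 in mean. In the limit \<open>q\<close> is
  symmetric when tested against functions of compact support, and by its continuity everywhere.
\<close>

subsection \<open>Potentials with a trapezoidal rule\<close>

text \<open>The gradient is only locally Lipschitz and \<Phi> has no prescribed growth, so no error
  bound holds uniformly on the whole space; hence the cut-off by balls. A ball of radius
  \<open>m\<close> costs a constant \<open>C m\<close> over which there is no control, and the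
  number of steps \<open>N m\<close> is fixed only after \<open>C m\<close>. This choice must not
  depend on the starting point: symmetry of the kernel powers is an identity integrated over all
  starting points, so one sequence of kernels has to converge for every one of them, although the
  Brownian motion and the solution may change from point to point. The size of the individual path
  enters only through the event of leaving the ball, which for each path eventually stops occurring.

  The cube is what makes the count work: with \<open>t / h\<close> steps and increments of size
  \<open>sqrt h\<close>, a defect quadratic in the increment would be of order \<open>h\<close> per
  step and leave a total of order 1.

  The factors in drift and noise are matched: \<open>1 / (N - 1)\<close> cancels in \<Phi> divided
  by the squared noise, which leaves exactly the part of the Gibbs exponent that contains
  \<open>V\<close> and \<open>U\<^sub>1\<close>.\<close>

text \<open>
  \<open>G\<close> plays the role of \<open>\<nabla>\<Phi>\<close>. The cubic error of the trapezoidal rule is all that is used of the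
  third derivatives of \<open>\<Phi>\<close>, and it passes to sums and translates.
\<close>

definition regular_potential :: "('a::euclidean_space \<Rightarrow> real) \<Rightarrow> ('a \<Rightarrow> 'a) \<Rightarrow> bool" where
  "regular_potential \<Phi> G \<longleftrightarrow>
     (\<forall>R. \<exists>L. \<forall>x\<in>cball 0 R. \<forall>y\<in>cball 0 R. norm (G y - G x) \<le> L * norm (y - x)) \<and>
     (\<forall>R. \<exists>C. \<forall>x\<in>cball 0 R. \<forall>y\<in>cball 0 R.
        \<bar>\<Phi> y - \<Phi> x - (y - x) \<bullet> (G x + G y) / 2\<bar> \<le> C * norm (y - x) ^ 3)"

lemma Ck_imp_continuous_on: "Ck k f \<Longrightarrow> continuous_on UNIV f"
  by (cases k) (auto dest: differentiable_imp_continuous_on)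

lemma Ck_Suc_directional:
  assumes "Ck (Suc k) f"
  shows "Ck k (\<lambda>x. frechet_derivative f (at x) v)"
  using assms by simp

text \<open>\<open>Ck\<close> speaks of derivatives in fixed directions only. Expanding in the basis
  expresses the full derivative by finitely many coefficients that are again of class
  \<open>Ck k\<close>, so that differentiation along a segment can be iterated.\<close>

lemma Ck_Suc_has_derivative:
  assumes "Ck (Suc k) f"
  shows "(f has_derivative (\<lambda>v. \<Sum>e\<in>Basis. (v \<bullet> e) * frechet_derivative f (at x) e)) (at x)"
proof -
  have d: "(f has_derivative frechet_derivative f (at x)) (at x)"
    using assms by (simp add: differentiable_on_def frechet_derivative_works)
  then have lin: "linear (frechet_derivative f (at x))"
    by (rule has_derivative_linear)
  have "frechet_derivative f (at x) v = (\<Sum>e\<in>Basis. (v \<bullet> e) * frechet_derivative f (at x) e)" for v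
    using linear_sum[OF lin, of "\<lambda>e. (v \<bullet> e) *\<^sub>R e" Basis] linear_scale[OF lin]
    by (simp add: euclidean_representation)
  then show ?thesis
    by (intro has_derivative_eq_rhs[OF d] ext)
qed

lemma Ck_Suc_DERIV_line:
  assumes "Ck (Suc k) f"
  shows "((\<lambda>r. f (x + r *\<^sub>R v)) has_real_derivative
    (\<Sum>e\<in>Basis. (v \<bullet> e) * frechet_derivative f (at (x + r *\<^sub>R v)) e)) (at r)"
proof -
  have 1: "((\<lambda>r. x + r *\<^sub>R v) has_derivative (\<lambda>s. s *\<^sub>R v)) (at r)"
    by (auto intro!: derivative_eq_intros)
  have "((\<lambda>r. f (x + r *\<^sub>R v)) has_derivative
     (\<lambda>s. \<Sum>e\<in>Basis. ((s *\<^sub>R v) \<bullet> e) * frechet_derivative f (at (x + r *\<^sub>R v)) e)) (at r)"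
    by (rule has_derivative_compose[OF 1 Ck_Suc_has_derivative[OF assms]])
  then show ?thesis
    unfolding has_field_derivative_def
    by (rule has_derivative_eq_rhs) (simp add: sum_distrib_left mult_ac fun_eq_iff)
qed

text \<open>\<open>gradient\<close> is a definite description, so the basis formula needs both
  existence and uniqueness of the vector representing the derivative.\<close>

lemma Ck_Suc_gradient:
  assumes "Ck (Suc k) f"
  shows "gradient f x = (\<Sum>e\<in>Basis. frechet_derivative f (at x) e *\<^sub>R e)"
proof -
  let ?g = "\<Sum>e\<in>Basis. frechet_derivative f (at x) e *\<^sub>R e"
  have "GDERIV f x :> ?g"
    using Ck_Suc_has_derivative[OF assms, of x]
    by (simp add: gderiv_def inner_sum_right mult_ac)
  moreover have "D = ?g" if "GDERIV f x :> D" for D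
    using that calculation has_derivative_unique[of f "\<lambda>h. h \<bullet> D" x "\<lambda>h. h \<bullet> ?g"]
    unfolding gderiv_def by (metis (no_types, lifting) inner_commute vector_eq_ldot)
  ultimately show ?thesis
    unfolding gradient_def by (rule the_equality)
qed

lemma bounded_on_cball:
  fixes F :: "'b \<Rightarrow> 'a::euclidean_space \<Rightarrow> real"
  assumes "finite I" "\<And>i. i \<in> I \<Longrightarrow> continuous_on UNIV (F i)"
  obtains B where "B \<ge> 0" "\<And>i x. i \<in> I \<Longrightarrow> x \<in> cball 0 R \<Longrightarrow> \<bar>F i x\<bar> \<le> B"
proof -
  have "\<exists>B. \<forall>x\<in>cball 0 R. \<bar>F i x\<bar> \<le> B" if "i \<in> I" for i
  proof -
    have "bounded (F i ` cball 0 R)"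
      using assms(2)[OF that] by (intro compact_imp_bounded compact_continuous_image)
        (auto intro: continuous_on_subset)
    then show ?thesis by (auto simp: bounded_iff)
  qed
  then obtain B where B: "\<And>i x. i \<in> I \<Longrightarrow> x \<in> cball 0 R \<Longrightarrow> \<bar>F i x\<bar> \<le> B i" by metis
  have "\<bar>F i x\<bar> \<le> (\<Sum>i\<in>I. \<bar>B i\<bar>)" if "i \<in> I" "x \<in> cball 0 R" for i x
    using B[OF that] member_le_sum[OF that(1), of "\<lambda>i. \<bar>B i\<bar>"] assms(1) by force
  then show ?thesis by (intro that[of "\<Sum>i\<in>I. \<bar>B i\<bar>"]) (auto simp: sum_nonneg)
qed

text \<open>The Lipschitz bound is the mean value theorem applied to each partial derivative. For
  the cubic bound, \<open>f\<close> is restricted to the segment from \<open>x\<close> to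
  \<open>y\<close> and expanded to third order, and its first derivative along the segment to second
  order. Balls are convex, so bounds on the derivatives over the ball apply along the
  segment.\<close>

lemma smooth_imp_regular_potential:
  fixes f :: "'a::euclidean_space \<Rightarrow> real"
  assumes "smooth f"
  shows "regular_potential f (gradient f)"
proof -
  have C3: "Ck (Suc 2) f" using assms unfolding smooth_def by blast
  define D1 where "D1 e x = frechet_derivative f (at x) e" for e x
  \<comment> \<open>Uncurried indices make the higher derivatives families over finite products of
    \<open>Basis\<close>, the form in which \<open>bounded_on_cball\<close> gives one bound for all
    of them.\<close>
  define D2 where "D2 = (\<lambda>(e,e') x. frechet_derivative (D1 e) (at x) e')"
  define D3 where "D3 = (\<lambda>((e,e'),e'') x. frechet_derivative (D2 (e,e')) (at x) e'')"
  have C2: "Ck (Suc 1) (D1 e)" for e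
    using Ck_Suc_directional[OF C3] by (simp add: D1_def[abs_def] numeral_2_eq_2)
  have C1: "Ck (Suc 0) (D2 e)" for e
    using Ck_Suc_directional[OF C2] by (cases e) (simp add: D2_def)
  have C0: "continuous_on UNIV (D3 e)" for e
    using Ck_Suc_directional[OF C1] by (cases e) (auto simp: D3_def)
  have grad: "gradient f x = (\<Sum>e\<in>Basis. D1 e x *\<^sub>R e)" for x
    using Ck_Suc_gradient[OF C3] by (simp add: D1_def)
  let ?B = "Basis :: 'a set" and ?d = "real DIM('a)"
  show ?thesis
    unfolding regular_potential_def
  proof (intro conjI allI)
    fix R :: real
    obtain B2 where B2: "B2 \<ge> 0" "\<And>i x. i \<in> ?B \<times> ?B \<Longrightarrow> x \<in> cball 0 R \<Longrightarrow> \<bar>D2 i x\<bar> \<le> B2"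
      using bounded_on_cball[of "?B \<times> ?B" D2 R] Ck_imp_continuous_on[OF C1] by auto
    obtain B3 where B3: "B3 \<ge> 0" "\<And>i x. i \<in> (?B \<times> ?B) \<times> ?B \<Longrightarrow> x \<in> cball 0 R \<Longrightarrow> \<bar>D3 i x\<bar> \<le> B3"
      using bounded_on_cball[of "(?B \<times> ?B) \<times> ?B" D3 R] C0 by auto
    have seg: "x + r *\<^sub>R (y - x) \<in> cball 0 R"
      if "x \<in> cball 0 R" "y \<in> cball 0 R" "0 \<le> r" "r \<le> 1" for x y :: 'a and r
    proof -
      have "(1 - r) *\<^sub>R x + r *\<^sub>R y \<in> cball 0 R"
        using that by (intro convexD[OF convex_cball]) auto
      then show ?thesis by (simp add: algebra_simps)
    qed
    show "\<exists>L. \<forall>x\<in>cball 0 R. \<forall>y\<in>cball 0 R. norm (gradient f y - gradient f x) \<le> L * norm (y - x)"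
    proof (intro exI ballI)
      fix x y :: 'a assume xy: "x \<in> cball 0 R" "y \<in> cball 0 R"
      let ?v = "y - x"
      have "\<bar>D1 e y - D1 e x\<bar> \<le> ?d * (B2 * norm ?v)" if e: "e \<in> ?B" for e
      proof -
        have "\<exists>r. 0 < r \<and> r < 1 \<and> D1 e (x + 1 *\<^sub>R ?v) - D1 e (x + 0 *\<^sub>R ?v) =
           (1 - 0) * (\<Sum>e'\<in>Basis. (?v \<bullet> e') * frechet_derivative (D1 e) (at (x + r *\<^sub>R ?v)) e')"
          by (rule MVT2) (use Ck_Suc_DERIV_line[OF C2] in auto)
        then obtain r where r: "0 < r" "r < 1"
          "D1 e y - D1 e x = (\<Sum>e'\<in>Basis. (?v \<bullet> e') * D2 (e, e') (x + r *\<^sub>R ?v))"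
          by (auto simp: D2_def)
        have "\<bar>D1 e y - D1 e x\<bar> \<le> (\<Sum>e'\<in>?B. norm ?v * B2)"
          unfolding r(3)
        proof (rule order_trans[OF sum_abs], rule sum_mono)
          fix e' assume e': "e' \<in> ?B"
          show "\<bar>(?v \<bullet> e') * D2 (e, e') (x + r *\<^sub>R ?v)\<bar> \<le> norm ?v * B2"
            unfolding abs_mult
            using B2(2)[of "(e,e')" "x + r *\<^sub>R ?v"] seg[OF xy] r e e'
            by (intro mult_mono Basis_le_norm) auto
        qed
        then show ?thesis by (simp add: mult_ac)
      qed
      then have "(\<Sum>e\<in>?B. \<bar>D1 e y - D1 e x\<bar>) \<le> (\<Sum>e\<in>?B. ?d * (B2 * norm ?v))"
        by (rule sum_mono)
      moreover have "norm (gradient f y - gradient f x) \<le> (\<Sum>e\<in>?B. \<bar>D1 e y - D1 e x\<bar>)"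
        unfolding grad sum_subtractf[symmetric] scaleR_diff_left[symmetric]
        by (rule order_trans[OF norm_sum]) (simp add: sum_mono)
      ultimately show "norm (gradient f y - gradient f x) \<le> (?d * (?d * B2)) * norm ?v"
        by (simp add: mult_ac)
    qed
    show "\<exists>C. \<forall>x\<in>cball 0 R. \<forall>y\<in>cball 0 R.
            \<bar>f y - f x - (y - x) \<bullet> (gradient f x + gradient f y) / 2\<bar> \<le> C * norm (y - x) ^ 3"
    proof (intro exI ballI)
      fix x y :: 'a assume xy: "x \<in> cball 0 R" "y \<in> cball 0 R"
      let ?v = "y - x" and ?z = "\<lambda>r. x + r *\<^sub>R (y - x)"
      define F1 where "F1 r = (\<Sum>e\<in>?B. (?v \<bullet> e) * D1 e (?z r))" for r
      define F2 where "F2 r = (\<Sum>e\<in>?B. (?v \<bullet> e) * (\<Sum>e'\<in>?B. (?v \<bullet> e') * D2 (e,e') (?z r)))" for r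
      define F3 where "F3 r = (\<Sum>e\<in>?B. (?v \<bullet> e) * (\<Sum>e'\<in>?B. (?v \<bullet> e') *
          (\<Sum>e''\<in>?B. (?v \<bullet> e'') * D3 ((e,e'),e'') (?z r))))" for r
      have dF0: "((\<lambda>r. f (?z r)) has_real_derivative F1 r) (at r)" for r
        using Ck_Suc_DERIV_line[OF C3] by (simp add: F1_def D1_def)
      have dF1: "(F1 has_real_derivative F2 r) (at r)" for r
        unfolding F1_def[abs_def] F2_def D2_def case_prod_conv
        by (intro DERIV_sum DERIV_cmult Ck_Suc_DERIV_line[OF C2])
      have dF2: "(F2 has_real_derivative F3 r) (at r)" for r
        unfolding F2_def[abs_def] F3_def D3_def case_prod_conv
        by (intro DERIV_sum DERIV_cmult Ck_Suc_DERIV_line[OF C1])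
      have bF3: "\<bar>F3 r\<bar> \<le> ?d ^ 3 * B3 * norm ?v ^ 3" if r: "0 < r" "r < 1" for r
      proof -
        have 1: "\<bar>(?v \<bullet> e) * s\<bar> \<le> norm ?v * S" if "e \<in> ?B" "\<bar>s\<bar> \<le> S" for e s S
          unfolding abs_mult using that by (intro mult_mono Basis_le_norm) auto
        have 2: "\<bar>\<Sum>e\<in>?B. (?v \<bullet> e) * s e\<bar> \<le> ?d * (norm ?v * S)"
          if "\<And>e. e \<in> ?B \<Longrightarrow> \<bar>s e\<bar> \<le> S" for s S
        proof -
          have "\<bar>\<Sum>e\<in>?B. (?v \<bullet> e) * s e\<bar> \<le> (\<Sum>e\<in>?B. norm ?v * S)"
            by (rule order_trans[OF sum_abs], rule sum_mono) (use 1 that in blast)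
          then show ?thesis by simp
        qed
        have "\<bar>F3 r\<bar> \<le> ?d * (norm ?v * (?d * (norm ?v * (?d * (norm ?v * B3)))))"
          unfolding F3_def using B3(2) seg[OF xy, of r] r by (intro 2) auto
        then show ?thesis by (simp add: power3_eq_cube mult_ac)
      qed
      let ?diff = "\<lambda>m::nat. if m = 0 then (\<lambda>r. f (?z r)) else if m = 1 then F1 else if m = 2 then F2 else F3"
      have "\<exists>r>0. r < 1 \<and> f (?z 1) = (\<Sum>m<3. ?diff m 0 / fact m * 1 ^ m) + ?diff 3 r / fact 3 * 1 ^ 3"
        by (rule Maclaurin) (use dF0 dF1 dF2 in \<open>auto simp: less_Suc_eq numeral_3_eq_3\<close>)
      then obtain r where r: "0 < r" "r < 1" "f y = f x + F1 0 + F2 0 / 2 + F3 r / 6"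
        by (auto simp: numeral_3_eq_3 fact_numeral)
      let ?diff' = "\<lambda>m::nat. if m = 0 then F1 else if m = 1 then F2 else F3"
      have "\<exists>r>0. r < 1 \<and> F1 1 = (\<Sum>m<2. ?diff' m 0 / fact m * 1 ^ m) + ?diff' 2 r / fact 2 * 1 ^ 2"
        by (rule Maclaurin) (use dF1 dF2 in \<open>auto simp: less_Suc_eq numeral_2_eq_2\<close>)
      then obtain r' where r': "0 < r'" "r' < 1" "F1 1 = F1 0 + F2 0 + F3 r' / 2"
        by (auto simp: numeral_2_eq_2)
      have F1g: "F1 0 = ?v \<bullet> gradient f x" "F1 1 = ?v \<bullet> gradient f y"
        by (simp_all add: F1_def grad inner_sum_right mult.commute)
      \<comment> \<open>Averaging \<open>F1 0\<close> and \<open>F1 1\<close> reproduces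
        \<open>F1 0 + F2 0 / 2\<close>, so only the two third-order remainders survive. Since
        \<open>1/6 + 1/4 < 1\<close>, the bound on \<open>F3\<close> serves as the final
        constant.\<close>
      have eq: "f y - f x - ?v \<bullet> (gradient f x + gradient f y) / 2 = F3 r / 6 - F3 r' / 4"
        using r(3) r'(3) by (simp add: inner_add_right F1g[symmetric] field_simps)
      show "\<bar>f y - f x - ?v \<bullet> (gradient f x + gradient f y) / 2\<bar> \<le> (?d ^ 3 * B3) * norm ?v ^ 3"
        unfolding eq using bF3[OF r(1,2)] bF3[OF r'(1,2)] by linarith
    qed
  qed
qed

lemma regular_potential_add:
  assumes "regular_potential \<Phi> G" "regular_potential \<Psi> H"
  shows "regular_potential (\<lambda>x. \<Phi> x + \<Psi> x) (\<lambda>x. G x + H x)"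
  unfolding regular_potential_def
proof (intro conjI allI)
  fix R :: real
  obtain L where L: "\<And>x y. x \<in> cball 0 R \<Longrightarrow> y \<in> cball 0 R \<Longrightarrow> norm (G y - G x) \<le> L * norm (y - x)"
    using assms(1) unfolding regular_potential_def by meson
  obtain L' where L': "\<And>x y. x \<in> cball 0 R \<Longrightarrow> y \<in> cball 0 R \<Longrightarrow> norm (H y - H x) \<le> L' * norm (y - x)"
    using assms(2) unfolding regular_potential_def by meson
  show "\<exists>L. \<forall>x\<in>cball 0 R. \<forall>y\<in>cball 0 R. norm (G y + H y - (G x + H x)) \<le> L * norm (y - x)"
  proof (intro exI ballI)
    fix x y :: 'a assume "x \<in> cball 0 R" "y \<in> cball 0 R"
    then show "norm (G y + H y - (G x + H x)) \<le> (L + L') * norm (y - x)"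
      using norm_triangle_ineq[of "G y - G x" "H y - H x"] L[of x y] L'[of x y]
      by (simp add: algebra_simps)
  qed
  obtain C where C: "\<And>x y. x \<in> cball 0 R \<Longrightarrow> y \<in> cball 0 R \<Longrightarrow>
      \<bar>\<Phi> y - \<Phi> x - (y - x) \<bullet> (G x + G y) / 2\<bar> \<le> C * norm (y - x) ^ 3"
    using assms(1) unfolding regular_potential_def by meson
  obtain C' where C': "\<And>x y. x \<in> cball 0 R \<Longrightarrow> y \<in> cball 0 R \<Longrightarrow>
      \<bar>\<Psi> y - \<Psi> x - (y - x) \<bullet> (H x + H y) / 2\<bar> \<le> C' * norm (y - x) ^ 3"
    using assms(2) unfolding regular_potential_def by meson
  show "\<exists>C. \<forall>x\<in>cball 0 R. \<forall>y\<in>cball 0 R.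
        \<bar>\<Phi> y + \<Psi> y - (\<Phi> x + \<Psi> x) - (y - x) \<bullet> (G x + H x + (G y + H y)) / 2\<bar> \<le> C * norm (y - x) ^ 3"
  proof (intro exI ballI)
    fix x y :: 'a assume xy: "x \<in> cball 0 R" "y \<in> cball 0 R"
    have "\<Phi> y + \<Psi> y - (\<Phi> x + \<Psi> x) - (y - x) \<bullet> (G x + H x + (G y + H y)) / 2 =
      (\<Phi> y - \<Phi> x - (y - x) \<bullet> (G x + G y) / 2) + (\<Psi> y - \<Psi> x - (y - x) \<bullet> (H x + H y) / 2)"
      by (simp add: inner_add_right field_simps)
    then show "\<bar>\<Phi> y + \<Psi> y - (\<Phi> x + \<Psi> x) - (y - x) \<bullet> (G x + H x + (G y + H y)) / 2\<bar>
        \<le> (C + C') * norm (y - x) ^ 3"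
      using C[OF xy] C'[OF xy] by (simp add: distrib_right)
  qed
qed

lemma regular_potential_scale:
  assumes "regular_potential \<Phi> G"
  shows "regular_potential (\<lambda>x. c * \<Phi> x) (\<lambda>x. c *\<^sub>R G x)"
  unfolding regular_potential_def
proof (intro conjI allI)
  fix R :: real
  obtain L where L: "\<And>x y. x \<in> cball 0 R \<Longrightarrow> y \<in> cball 0 R \<Longrightarrow> norm (G y - G x) \<le> L * norm (y - x)"
    using assms(1) unfolding regular_potential_def by meson
  show "\<exists>L. \<forall>x\<in>cball 0 R. \<forall>y\<in>cball 0 R. norm (c *\<^sub>R G y - c *\<^sub>R G x) \<le> L * norm (y - x)"
  proof (intro exI ballI)
    fix x y :: 'a assume "x \<in> cball 0 R" "y \<in> cball 0 R"
    then show "norm (c *\<^sub>R G y - c *\<^sub>R G x) \<le> (\<bar>c\<bar> * L) * norm (y - x)"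
      using mult_left_mono[OF L, of x y "\<bar>c\<bar>"] by (simp add: scaleR_diff_right[symmetric] mult_ac)
  qed
  obtain C where C: "\<And>x y. x \<in> cball 0 R \<Longrightarrow> y \<in> cball 0 R \<Longrightarrow>
      \<bar>\<Phi> y - \<Phi> x - (y - x) \<bullet> (G x + G y) / 2\<bar> \<le> C * norm (y - x) ^ 3"
    using assms(1) unfolding regular_potential_def by meson
  show "\<exists>C. \<forall>x\<in>cball 0 R. \<forall>y\<in>cball 0 R.
        \<bar>c * \<Phi> y - c * \<Phi> x - (y - x) \<bullet> (c *\<^sub>R G x + c *\<^sub>R G y) / 2\<bar> \<le> C * norm (y - x) ^ 3"
  proof (intro exI ballI)
    fix x y :: 'a assume xy: "x \<in> cball 0 R" "y \<in> cball 0 R"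
    have "c * \<Phi> y - c * \<Phi> x - (y - x) \<bullet> (c *\<^sub>R G x + c *\<^sub>R G y) / 2 =
      c * (\<Phi> y - \<Phi> x - (y - x) \<bullet> (G x + G y) / 2)"
      by (simp add: inner_add_right field_simps)
    then show "\<bar>c * \<Phi> y - c * \<Phi> x - (y - x) \<bullet> (c *\<^sub>R G x + c *\<^sub>R G y) / 2\<bar>
        \<le> (\<bar>c\<bar> * C) * norm (y - x) ^ 3"
      using mult_left_mono[OF C[OF xy], of "\<bar>c\<bar>"] by (simp add: abs_mult mult_ac)
  qed
qed

lemma regular_potential_translate:
  fixes a :: "'a::euclidean_space"
  assumes "regular_potential \<Phi> G"
  shows "regular_potential (\<lambda>x. \<Phi> (x - a)) (\<lambda>x. G (x - a))"
  unfolding regular_potential_def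
proof (intro conjI allI)
  fix R :: real
  have sub: "x - a \<in> cball 0 (R + norm a)" if "x \<in> cball 0 R" for x
    using that norm_triangle_ineq4[of x a] by (auto simp: dist_norm norm_minus_commute)
  show "\<exists>L. \<forall>x\<in>cball 0 R. \<forall>y\<in>cball 0 R. norm (G (y - a) - G (x - a)) \<le> L * norm (y - x)"
  proof -
    obtain L where "\<And>x y. x \<in> cball 0 (R + norm a) \<Longrightarrow> y \<in> cball 0 (R + norm a) \<Longrightarrow>
        norm (G y - G x) \<le> L * norm (y - x)"
      using assms(1) unfolding regular_potential_def by meson
    from this[OF sub sub] show ?thesis by (intro exI[of _ L]) simp
  qed
  obtain C where "\<And>x y. x \<in> cball 0 (R + norm a) \<Longrightarrow> y \<in> cball 0 (R + norm a) \<Longrightarrow>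
      \<bar>\<Phi> y - \<Phi> x - (y - x) \<bullet> (G x + G y) / 2\<bar> \<le> C * norm (y - x) ^ 3"
    using assms(1) unfolding regular_potential_def by meson
  from this[OF sub sub]
  show "\<exists>C. \<forall>x\<in>cball 0 R. \<forall>y\<in>cball 0 R. \<bar>\<Phi> (y - a) - \<Phi> (x - a) -
     (y - x) \<bullet> (G (x - a) + G (y - a)) / 2\<bar> \<le> C * norm (y - x) ^ 3"
    by (intro exI[of _ C]) simp
qed

lemma regular_potential_sum:
  assumes "finite I" "\<And>i. i \<in> I \<Longrightarrow> regular_potential (\<Phi> i) (G i)"
  shows "regular_potential (\<lambda>x. \<Sum>i\<in>I. \<Phi> i x) (\<lambda>x. \<Sum>i\<in>I. G i x)"
  using assms
proof (induction I rule: finite_induct)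
  case empty
  show ?case by (auto simp: regular_potential_def intro: exI[of _ 0])
next
  case (insert i I)
  then show ?case using regular_potential_add[of "\<Phi> i" "G i"] by simp
qed

text \<open>Continuity of \<Phi> is hidden in the trapezoidal bound: it compares the increment of
  \<Phi> with \<open>(y - x) \<bullet> (G x + G y) / 2\<close>, which vanishes as \<open>y\<close>
  tends to \<open>x\<close> because \<open>G\<close> is continuous. Each point is handled in the
  ball of radius \<open>norm x + 1\<close>.\<close>

lemma regular_potential_continuous:
  fixes \<Phi> :: "'a::euclidean_space \<Rightarrow> real"
  assumes "regular_potential \<Phi> G"
  shows "continuous_on UNIV G" "continuous_on UNIV \<Phi>"
proof -
  have cont: "continuous_on UNIV G"
  proof (clarsimp simp: continuous_on_eq_continuous_at)
    fix x :: 'a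
    let ?R = "norm x + 1"
    obtain L where L: "\<And>x y. x \<in> cball 0 ?R \<Longrightarrow> y \<in> cball 0 ?R \<Longrightarrow> norm (G y - G x) \<le> L * norm (y - x)"
      using assms(1) unfolding regular_potential_def by meson
    have "eventually (\<lambda>y. y \<in> ball x 1) (at x)"
      by (rule eventually_at_in_open') auto
    then have "eventually (\<lambda>y. norm (G y - G x) \<le> L * norm (y - x)) (at x)"
    proof eventually_elim
      case (elim y)
      have "norm y \<le> norm x + norm (y - x)" by norm
      with elim show ?case by (intro L) (auto simp: dist_norm norm_minus_commute)
    qed
    moreover have "((\<lambda>y. L * norm (y - x)) \<longlongrightarrow> L * norm (x - x)) (at x)"
      by (intro tendsto_intros)
    then have "((\<lambda>y. L * norm (y - x)) \<longlongrightarrow> 0) (at x)"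
      by simp
    ultimately have "((\<lambda>y. G y - G x) \<longlongrightarrow> 0) (at x)"
      by (rule Lim_null_comparison)
    then show "isCont G x" by (simp add: isCont_def LIM_zero_iff)
  qed
  then show "continuous_on UNIV G" .
  show "continuous_on UNIV \<Phi>"
  proof (clarsimp simp: continuous_on_eq_continuous_at)
    fix x :: 'a
    let ?R = "norm x + 1"
    obtain C where C: "\<And>x y. x \<in> cball 0 ?R \<Longrightarrow> y \<in> cball 0 ?R \<Longrightarrow>
       \<bar>\<Phi> y - \<Phi> x - (y - x) \<bullet> (G x + G y) / 2\<bar> \<le> C * norm (y - x) ^ 3"
      using assms(1) unfolding regular_potential_def by meson
    have "eventually (\<lambda>y. y \<in> ball x 1) (at x)"
      by (rule eventually_at_in_open') auto
    then have "eventually (\<lambda>y. norm (\<Phi> y - \<Phi> x) \<le>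
        C * norm (y - x) ^ 3 + \<bar>(y - x) \<bullet> (G x + G y) / 2\<bar>) (at x)"
    proof eventually_elim
      case (elim y)
      have "norm y \<le> norm x + norm (y - x)" by norm
      with elim have "\<bar>\<Phi> y - \<Phi> x - (y - x) \<bullet> (G x + G y) / 2\<bar> \<le> C * norm (y - x) ^ 3"
        by (intro C) (auto simp: dist_norm norm_minus_commute)
      then show ?case unfolding real_norm_def by linarith
    qed
    moreover have G: "(G \<longlongrightarrow> G x) (at x)"
      using cont by (simp add: continuous_on_eq_continuous_at isCont_def)
    have "((\<lambda>y. C * norm (y - x) ^ 3 + \<bar>(y - x) \<bullet> (G x + G y) / 2\<bar>) \<longlongrightarrow>
       C * norm (x - x) ^ 3 + \<bar>(x - x) \<bullet> (G x + G x) / 2\<bar>) (at x)"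
      by (intro tendsto_intros G) auto
    then have "((\<lambda>y. C * norm (y - x) ^ 3 + \<bar>(y - x) \<bullet> (G x + G y) / 2\<bar>) \<longlongrightarrow> 0) (at x)"
      by simp
    ultimately have "((\<lambda>y. \<Phi> y - \<Phi> x) \<longlongrightarrow> 0) (at x)"
      by (rule Lim_null_comparison)
    then show "isCont \<Phi> x" by (simp add: isCont_def LIM_zero_iff)
  qed
qed

subsection \<open>Gaussian densities\<close>

text \<open>The product form is literally the one in \<open>brownian_motion\<close>, with
  \<open>s\<close> the standard deviation of each coordinate; \<open>gauss_eq\<close> provides the
  radial form needed for ratios of densities.\<close>

definition gauss :: "real \<Rightarrow> 'a::euclidean_space \<Rightarrow> real" where
  "gauss s x = (\<Prod>e\<in>Basis. normal_density 0 s (x \<bullet> e))"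

lemma gauss_eq:
  fixes x :: "'a::euclidean_space"
  shows "gauss s x = (1 / sqrt (2 * pi * s\<^sup>2)) ^ DIM('a) * exp (- (norm x)\<^sup>2 / (2 * s\<^sup>2))"
proof -
  have "(norm x)\<^sup>2 = (\<Sum>e\<in>Basis. (x \<bullet> e)\<^sup>2)"
    unfolding power2_norm_eq_inner by (subst euclidean_inner) (simp add: power2_eq_square)
  then have "exp (- (norm x)\<^sup>2 / (2 * s\<^sup>2)) = (\<Prod>e\<in>Basis. exp (- (x \<bullet> e)\<^sup>2 / (2 * s\<^sup>2)))"
    by (simp add: exp_sum[symmetric] sum_negf sum_divide_distrib)
  then show ?thesis
    unfolding gauss_def normal_density_def by (simp only: prod.distrib prod_constant) simp
qed

lemma gauss_nonneg [simp]: "0 \<le> gauss s x"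
  unfolding gauss_def by (intro prod_nonneg) simp

lemma borel_measurable_gauss [measurable]: "gauss s \<in> borel_measurable borel"
  unfolding gauss_def[abs_def] by measurable

lemma nn_integral_gauss:
  assumes "s > 0"
  shows "(\<integral>\<^sup>+x. ennreal (gauss s (x::'a::euclidean_space)) \<partial>lborel) = 1"
proof -
  have "(\<integral>\<^sup>+x. ennreal (normal_density 0 s x) \<partial>lborel) = 1"
    using assms by (subst nn_integral_eq_integral) auto
  then have "(\<integral>\<^sup>+x. (\<Prod>e\<in>Basis. ennreal (normal_density 0 s ((x::'a) \<bullet> e))) \<partial>lborel) = 1"
    by (subst nn_integral_lborel_prod) simp_all
  then show ?thesis
    by (simp add: gauss_def prod_ennreal)
qed

lemma prob_space_gauss:
  "s > 0 \<Longrightarrow> prob_space (density lborel (\<lambda>x. ennreal (gauss s (x::'a::euclidean_space))))"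
  using nn_integral_gauss by (intro prob_spaceI) (simp add: emeasure_density)

text \<open>The norm is at most \<open>d\<close> times the largest coordinate, so its cube is at
  most \<open>d ^ 3\<close> times the sum of the cubed coordinates. Each coordinate has third
  absolute moment \<open>2 * sqrt (2 / pi) * s ^ 3\<close>, and summing over \<open>d\<close>
  coordinates gives the fourth power.\<close>

lemma nn_integral_gauss_norm_cube:
  assumes "s > 0"
  shows "(\<integral>\<^sup>+x. ennreal (gauss s x * norm (x::'a::euclidean_space) ^ 3) \<partial>lborel)
    \<le> ennreal (real DIM('a) ^ 4 * 2 * sqrt (2 / pi) * s ^ 3)"
proof -
  let ?d = "real DIM('a)"
  have comp: "(\<integral>\<^sup>+x. ennreal (gauss s (x::'a) * \<bar>x \<bullet> e\<bar> ^ 3) \<partial>lborel) = ennreal (2 * s ^ 3 * sqrt (2 / pi))"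
    if e: "e \<in> Basis" for e
  proof -
    \<comment> \<open>The cube is attached to the factor of coordinate \<open>e\<close> alone, so
      the integral remains a product, all of whose other factors are 1.\<close>
    let ?f = "\<lambda>b y. normal_density 0 s y * (if b = e then \<bar>y\<bar> ^ 3 else 1)"
    have eq: "gauss s x * \<bar>x \<bullet> e\<bar> ^ 3 = (\<Prod>b\<in>Basis. ?f b (x \<bullet> b))" for x :: 'a
      using e by (simp add: gauss_def prod.distrib)
    have 1: "(\<integral>\<^sup>+y. ennreal (?f b y) \<partial>lborel) = (if b = e then ennreal (2 * s ^ 3 * sqrt (2 / pi)) else 1)"
      for b
    proof (cases "b = e")
      case True
      have "has_bochner_integral lborel (\<lambda>x. normal_density 0 s x * \<bar>x\<bar> ^ 3) (2 * s ^ 3 * sqrt (2 / pi))"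
        using normal_moment_abs_odd[OF assms, of 0 1] by simp
      then have "(\<integral>\<^sup>+y. ennreal (normal_density 0 s y * \<bar>y\<bar> ^ 3) \<partial>lborel) = ennreal (2 * s ^ 3 * sqrt (2 / pi))"
        using assms by (subst nn_integral_eq_integral) (auto simp: has_bochner_integral_iff)
      with True show ?thesis by simp
    next
      case False
      then show ?thesis
        using assms by (simp, subst nn_integral_eq_integral) auto
    qed
    have "(\<integral>\<^sup>+x. ennreal (gauss s x * \<bar>x \<bullet> e\<bar> ^ 3) \<partial>lborel) =
        (\<integral>\<^sup>+x. (\<Prod>b\<in>Basis. ennreal (?f b ((x::'a) \<bullet> b))) \<partial>lborel)"
      unfolding eq by (subst prod_ennreal) auto
    also have "\<dots> = (\<Prod>b\<in>(Basis::'a set). \<integral>\<^sup>+y. ennreal (?f b y) \<partial>lborel)"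
      by (rule nn_integral_lborel_prod) (auto split: if_splits)
    also have "\<dots> = ennreal (2 * s ^ 3 * sqrt (2 / pi))"
      unfolding 1 using e by simp
    finally show ?thesis .
  qed
  have bound: "norm x ^ 3 \<le> (\<Sum>e\<in>Basis. ?d ^ 3 * \<bar>x \<bullet> e\<bar> ^ 3)" for x :: 'a
  proof -
    have "Max ((\<lambda>e. \<bar>x \<bullet> e\<bar>) ` Basis) \<in> (\<lambda>e. \<bar>x \<bullet> e\<bar>) ` Basis"
      by (rule Max_in) auto
    then obtain e where e: "e \<in> Basis" "Max ((\<lambda>e. \<bar>x \<bullet> e\<bar>) ` Basis) = \<bar>x \<bullet> e\<bar>"
      by blast
    have "norm x \<le> (\<Sum>b\<in>Basis. \<bar>x \<bullet> b\<bar>)" by (rule norm_le_l1)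
    also have "\<dots> \<le> (\<Sum>b\<in>(Basis::'a set). \<bar>x \<bullet> e\<bar>)"
      unfolding e(2)[symmetric] by (intro sum_mono Max_ge) auto
    finally have "norm x ^ 3 \<le> (?d * \<bar>x \<bullet> e\<bar>) ^ 3" by (intro power_mono) auto
    also have "\<dots> \<le> (\<Sum>e\<in>Basis. ?d ^ 3 * \<bar>x \<bullet> e\<bar> ^ 3)"
      using member_le_sum[OF e(1), of "\<lambda>e. ?d ^ 3 * \<bar>x \<bullet> e\<bar> ^ 3"] by (simp add: power_mult_distrib)
    finally show ?thesis .
  qed
  have "(\<integral>\<^sup>+x. ennreal (gauss s x * norm (x::'a) ^ 3) \<partial>lborel) \<le>
      (\<integral>\<^sup>+x. (\<Sum>e\<in>Basis. ennreal (?d ^ 3) * ennreal (gauss s x * \<bar>(x::'a) \<bullet> e\<bar> ^ 3)) \<partial>lborel)"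
  proof (rule nn_integral_mono)
    fix x :: 'a
    have "gauss s x * norm x ^ 3 \<le> gauss s x * (\<Sum>e\<in>Basis. ?d ^ 3 * \<bar>x \<bullet> e\<bar> ^ 3)"
      by (intro mult_left_mono bound) simp
    also have "\<dots> = (\<Sum>e\<in>Basis. ?d ^ 3 * (gauss s x * \<bar>x \<bullet> e\<bar> ^ 3))"
      by (simp add: sum_distrib_left mult_ac)
    finally show "ennreal (gauss s x * norm x ^ 3) \<le>
        (\<Sum>e\<in>Basis. ennreal (?d ^ 3) * ennreal (gauss s x * \<bar>x \<bullet> e\<bar> ^ 3))"
      by (simp add: ennreal_mult[symmetric] sum_ennreal ennreal_leI)
  qed
  also have "\<dots> = (\<Sum>e\<in>(Basis::'a set). ennreal (?d ^ 3) * ennreal (2 * s ^ 3 * sqrt (2 / pi)))"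
    using comp by (simp add: nn_integral_sum nn_integral_cmult)
  also have "\<dots> = (\<Sum>e\<in>(Basis::'a set). ennreal (?d ^ 3 * (2 * s ^ 3 * sqrt (2 / pi))))"
    using assms by (simp add: ennreal_mult[symmetric])
  also have "\<dots> = ennreal (?d * (?d ^ 3 * (2 * s ^ 3 * sqrt (2 / pi))))"
    using assms by (subst sum_ennreal) auto
  also have "?d * (?d ^ 3 * (2 * s ^ 3 * sqrt (2 / pi))) = ?d ^ 4 * 2 * sqrt (2 / pi) * s ^ 3"
    by (simp add: eval_nat_numeral)
  finally show ?thesis .
qed

text \<open>Change of variables \<open>z = c + \<sigma> y\<close>; the Jacobian is absorbed by the
  normalising constant of the wider Gaussian. This turns an average over the noise of one Euler step
  into an integral against \<open>euler_density\<close>.\<close>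

lemma nn_integral_gauss_affine:
  fixes c :: "'a::euclidean_space"
  assumes "\<sigma> > 0" "r > 0" and [measurable]: "f \<in> borel_measurable borel"
  shows "(\<integral>\<^sup>+y. f (c + \<sigma> *\<^sub>R y) * ennreal (gauss r y) \<partial>lborel) =
         (\<integral>\<^sup>+z. f z * ennreal (gauss (\<sigma> * r) (z - c)) \<partial>lborel)"
proof -
  have scale: "\<sigma> ^ DIM('a) * gauss (\<sigma> * r) (\<sigma> *\<^sub>R y) = gauss r y" for y :: 'a
  proof -
    have "\<sigma> ^ DIM('a) * (1 / sqrt (2 * pi * (\<sigma> * r)\<^sup>2)) ^ DIM('a) = (1 / sqrt (2 * pi * r\<^sup>2)) ^ DIM('a)"
      unfolding power_mult_distrib[symmetric] using assms(1,2)
      by (simp add: real_sqrt_mult field_simps power_mult_distrib)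
    moreover have "(norm (\<sigma> *\<^sub>R y))\<^sup>2 / (2 * (\<sigma> * r)\<^sup>2) = (norm y)\<^sup>2 / (2 * r\<^sup>2)"
      using assms(1,2) by (simp add: power_mult_distrib)
    ultimately show ?thesis
      unfolding gauss_eq by (simp add: mult.assoc[symmetric])
  qed
  have "(\<integral>\<^sup>+z. f z * ennreal (gauss (\<sigma> * r) (z - c)) \<partial>lborel) =
     (\<integral>\<^sup>+z. f z * ennreal (gauss (\<sigma> * r) (z - c))
        \<partial>density (distr lborel borel (\<lambda>x. c + \<sigma> *\<^sub>R x)) (\<lambda>_. ennreal (\<bar>\<sigma>\<bar> ^ DIM('a))))"
    using lborel_affine[of \<sigma> c] assms(1) by simp
  also have "\<dots> = (\<integral>\<^sup>+y. ennreal (\<sigma> ^ DIM('a)) * (f (c + \<sigma> *\<^sub>R y) * ennreal (gauss (\<sigma> * r) (\<sigma> *\<^sub>R y))) \<partial>lborel)"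
    using assms(1) by (simp add: nn_integral_density nn_integral_distr)
  also have "\<dots> = (\<integral>\<^sup>+y. f (c + \<sigma> *\<^sub>R y) * ennreal (gauss r y) \<partial>lborel)"
    using assms(1)
    by (intro nn_integral_cong) (simp add: scale[symmetric] ennreal_mult mult_ac)
  finally show ?thesis by simp
qed

subsection \<open>The Metropolised Euler chain\<close>

locale langevin =
  fixes \<Phi> :: "'a::euclidean_space \<Rightarrow> real" and G :: "'a \<Rightarrow> 'a" and \<sigma> :: real
  assumes potential: "regular_potential \<Phi> G" and \<sigma>: "\<sigma> > 0"
begin

lemma G_measurable [measurable]: "G \<in> borel_measurable borel"
  and \<Phi>_measurable [measurable]: "\<Phi> \<in> borel_measurable borel"
  using regular_potential_continuous[OF potential] by (auto intro: borel_measurable_continuous_onI)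

definition stat :: "'a \<Rightarrow> real" where
  "stat x = exp (- 2 * \<Phi> x / \<sigma>\<^sup>2)"

definition euler_density :: "real \<Rightarrow> 'a \<Rightarrow> 'a \<Rightarrow> real" where
  "euler_density h x y = gauss (\<sigma> * sqrt h) (y - (x - h *\<^sub>R G x))"

text \<open>
  Minus the logarithm of the Metropolis ratio
  \<open>(stat y * euler_density h y x) / (stat x * euler_density h x y)\<close>; the terms of order \<open>1 / h\<close>
  cancel.
\<close>

definition defect :: "real \<Rightarrow> 'a \<Rightarrow> 'a \<Rightarrow> real" where
  "defect h x y = 2 / \<sigma>\<^sup>2 * (\<Phi> y - \<Phi> x - (y - x) \<bullet> (G x + G y) / 2) +
     h / (2 * \<sigma>\<^sup>2) * ((norm (G y))\<^sup>2 - (norm (G x))\<^sup>2)"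

definition accept :: "real \<Rightarrow> real \<Rightarrow> 'a \<Rightarrow> 'a \<Rightarrow> real" where
  "accept h R x y = (if x \<in> cball 0 R \<and> y \<in> cball 0 R then min 1 (exp (- defect h x y)) else 0)"

text \<open>
  Rejected moves are dropped instead of staying put: the kernel is sub-Markov, and only paths all
  of whose moves are accepted contribute to its powers.
\<close>

definition kernel :: "real \<Rightarrow> real \<Rightarrow> ('a \<Rightarrow> ennreal) \<Rightarrow> 'a \<Rightarrow> ennreal" where
  "kernel h R f x = (\<integral>\<^sup>+y. ennreal (euler_density h x y * accept h R x y) * f y \<partial>lborel)"

lemma accept_nonneg: "0 \<le> accept h R x y" and accept_le_1: "accept h R x y \<le> 1"
  by (auto simp: accept_def)

lemma stat_pos: "0 < stat x"
  by (simp add: stat_def)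

lemma stat_measurable [measurable]: "stat \<in> borel_measurable borel"
  unfolding stat_def[abs_def] by measurable

lemma accept_measurable [measurable]: "case_prod (accept h R) \<in> borel_measurable (borel \<Otimes>\<^sub>M borel)"
  unfolding accept_def defect_def mem_cball_0 by measurable

lemma euler_density_measurable [measurable]:
  "case_prod (euler_density h) \<in> borel_measurable (borel \<Otimes>\<^sub>M borel)"
  unfolding euler_density_def by measurable

text \<open>The Gaussian constants agree because the noise is constant, and
  \<open>(norm (y - x))\<^sup>2\<close> occurs on both sides. The cross terms of the two squares
  combine to the trapezoidal sum of \<open>G\<close>, and the terms with the factor
  \<open>h\<^sup>2\<close> become the second summand of \<open>defect\<close>.\<close>

lemma euler_density_defect:
  assumes "h > 0"
  shows "stat x * euler_density h x y * exp (- defect h x y) = stat y * euler_density h y x"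
proof -
  let ?u = "y - x"
  have gen: "(norm (a + c *\<^sub>R b))\<^sup>2 = (norm a)\<^sup>2 + 2 * c * (a \<bullet> b) + c\<^sup>2 * (norm b)\<^sup>2" for a b :: 'a and c
    unfolding power2_norm_eq_inner
    by (simp add: inner_add_left inner_add_right inner_commute power2_eq_square)
  have n: "(norm (y - (x - h *\<^sub>R G x)))\<^sup>2 = (norm ?u)\<^sup>2 + 2 * h * (?u \<bullet> G x) + h\<^sup>2 * (norm (G x))\<^sup>2"
    using gen[of ?u h "G x"] by (simp add: algebra_simps)
  have n': "(norm (x - (y - h *\<^sub>R G y)))\<^sup>2 = (norm ?u)\<^sup>2 - 2 * h * (?u \<bullet> G y) + h\<^sup>2 * (norm (G y))\<^sup>2"
    using gen[of ?u "- h" "G y"] norm_minus_commute[of "?u + (- h) *\<^sub>R G y" 0]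
      norm_minus_commute[of "y - h *\<^sub>R G y" x] by (simp add: algebra_simps)
  \<comment> \<open>The identity of exponents with the vectors abstracted away: \<open>q\<close> is
    the squared noise, \<open>n\<close> the squared distance, \<open>p1\<close> and
    \<open>p2\<close> the inner products of \<open>y - x\<close> with \<open>G x\<close> and
    \<open>G y\<close>, \<open>a\<close> and \<open>b\<close> the squared norms of
    \<open>G x\<close> and \<open>G y\<close>.\<close>
  have alg: "- 2 * fx / q + - (n + 2 * h * p1 + h\<^sup>2 * a) / (2 * (q * h)) +
      - (2 / q * (fy - fx - (p1 + p2) / 2) + h / (2 * q) * (b - a)) =
      - 2 * fy / q + - (n - 2 * h * p2 + h\<^sup>2 * b) / (2 * (q * h))"
    if "q > 0" "h > 0" for q h fx fy p1 p2 n a b :: real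
    using that by (simp add: field_simps power2_eq_square)
  have sq: "(\<sigma> * sqrt h)\<^sup>2 = \<sigma>\<^sup>2 * h"
    using assms by (simp add: power_mult_distrib)
  have "- 2 * \<Phi> x / \<sigma>\<^sup>2 + - (norm (y - (x - h *\<^sub>R G x)))\<^sup>2 / (2 * (\<sigma>\<^sup>2 * h)) + - defect h x y =
     - 2 * \<Phi> y / \<sigma>\<^sup>2 + - (norm (x - (y - h *\<^sub>R G y)))\<^sup>2 / (2 * (\<sigma>\<^sup>2 * h))"
    unfolding defect_def n n' inner_add_right using assms \<sigma> by (intro alg) auto
  then have "exp (- 2 * \<Phi> x / \<sigma>\<^sup>2) * exp (- (norm (y - (x - h *\<^sub>R G x)))\<^sup>2 / (2 * (\<sigma>\<^sup>2 * h))) * exp (- defect h x y) =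
     exp (- 2 * \<Phi> y / \<sigma>\<^sup>2) * exp (- (norm (x - (y - h *\<^sub>R G y)))\<^sup>2 / (2 * (\<sigma>\<^sup>2 * h)))"
    by (simp add: exp_add[symmetric])
  then show ?thesis
    unfolding stat_def euler_density_def gauss_eq sq by (simp add: mult_ac)
qed

lemma euler_density_nonneg [simp]: "0 \<le> euler_density h x y"
  by (simp add: euler_density_def)

text \<open>The Metropolis mechanism: since \<open>a * min 1 b = min a (a * b)\<close>, both sides
  equal the minimum of \<open>stat x * euler_density h x y\<close> and
  \<open>stat y * euler_density h y x\<close> inside the ball, and 0 otherwise. The cut-off keeps
  this exact because it treats both arguments alike.\<close>

lemma kernel_density_symmetric:
  assumes "h > 0"
  shows "stat x * (euler_density h x y * accept h R x y) = stat y * (euler_density h y x * accept h R y x)"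
proof -
  have min: "a * min 1 b = min a (a * b)" if "a \<ge> 0" for a b :: real
    using that by (simp add: min_mult_distrib_left)
  show ?thesis
    unfolding accept_def mult.assoc[symmetric]
    using min[of "stat x * euler_density h x y" "exp (- defect h x y)"]
      min[of "stat y * euler_density h y x" "exp (- defect h y x)"] stat_pos[of x] stat_pos[of y]
    by (simp add: euler_density_defect[OF assms] min.commute less_imp_le)
qed

lemma kernel_measurable [measurable]:
  assumes [measurable]: "f \<in> borel_measurable borel"
  shows "kernel h R f \<in> borel_measurable borel"
  unfolding kernel_def[abs_def] by measurable

lemma kernel_pow_measurable [measurable]:
  assumes "f \<in> borel_measurable borel"
  shows "(kernel h R ^^ n) f \<in> borel_measurable borel"
  using assms by (induction n) auto

lemma kernel_symmetric:
  assumes h: "h > 0" and [measurable]: "f \<in> borel_measurable borel" "g \<in> borel_measurable borel"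
  shows "(\<integral>\<^sup>+x. ennreal (stat x) * (f x * kernel h R g x) \<partial>lborel) =
         (\<integral>\<^sup>+x. ennreal (stat x) * (kernel h R f x * g x) \<partial>lborel)"
proof -
  let ?k = "\<lambda>x y. euler_density h x y * accept h R x y"
  have "(\<integral>\<^sup>+x. ennreal (stat x) * (f x * kernel h R g x) \<partial>lborel) =
        (\<integral>\<^sup>+x. \<integral>\<^sup>+y. f x * g y * (ennreal (stat x) * ennreal (?k x y)) \<partial>lborel \<partial>lborel)"
    unfolding kernel_def
    by (subst nn_integral_cmult[symmetric], simp)+ (simp add: mult_ac)
  also have "\<dots> = (\<integral>\<^sup>+y. \<integral>\<^sup>+x. f x * g y * (ennreal (stat x) * ennreal (?k x y)) \<partial>lborel \<partial>lborel)"
    by (rule lborel_pair.Fubini') measurable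
  also have "\<dots> = (\<integral>\<^sup>+y. \<integral>\<^sup>+x. f x * g y * (ennreal (stat y) * ennreal (?k y x)) \<partial>lborel \<partial>lborel)"
    using stat_pos
    by (simp add: ennreal_mult[symmetric] accept_nonneg less_imp_le kernel_density_symmetric[OF h])
  also have "\<dots> = (\<integral>\<^sup>+x. ennreal (stat x) * (kernel h R f x * g x) \<partial>lborel)"
    unfolding kernel_def
    by (subst nn_integral_multc[symmetric], simp, subst nn_integral_cmult[symmetric], simp)
       (simp add: mult_ac)
  finally show ?thesis .
qed

text \<open>Each induction step moves one kernel from \<open>g\<close> onto \<open>f\<close>, which
  is why \<open>f\<close> is generalised.\<close>

lemma kernel_pow_symmetric:
  assumes h: "h > 0" and f: "f \<in> borel_measurable borel" and g: "g \<in> borel_measurable borel"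
  shows "(\<integral>\<^sup>+x. ennreal (stat x) * (f x * (kernel h R ^^ n) g x) \<partial>lborel) =
         (\<integral>\<^sup>+x. ennreal (stat x) * (g x * (kernel h R ^^ n) f x) \<partial>lborel)"
  using f
proof (induction n arbitrary: f)
  case 0
  then show ?case by (simp add: mult_ac)
next
  case (Suc n)
  have "(\<integral>\<^sup>+x. ennreal (stat x) * (f x * (kernel h R ^^ Suc n) g x) \<partial>lborel) =
        (\<integral>\<^sup>+x. ennreal (stat x) * (kernel h R f x * (kernel h R ^^ n) g x) \<partial>lborel)"
    using kernel_symmetric[OF h Suc.prems kernel_pow_measurable[OF g]] by simp
  also have "\<dots> = (\<integral>\<^sup>+x. ennreal (stat x) * (g x * (kernel h R ^^ n) (kernel h R f) x) \<partial>lborel)"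
    by (rule Suc.IH) (use Suc.prems in measurable)
  finally show ?case by (simp only: funpow_Suc_right o_apply)
qed

section \<open>Paths of the Euler chain and the kernel powers as expectations over them\<close>

text \<open>The entries of \<xi> are unnormalised noise increments, of standard deviation
  \<open>sqrt h\<close> when they come from Brownian motion; hence no factor \<open>sqrt h\<close>
  appears.\<close>

primrec chain :: "real \<Rightarrow> 'a \<Rightarrow> (nat \<Rightarrow> 'a) \<Rightarrow> nat \<Rightarrow> 'a" where
  "chain h x \<xi> 0 = x"
| "chain h x \<xi> (Suc k) = chain h x \<xi> k - h *\<^sub>R G (chain h x \<xi> k) + \<sigma> *\<^sub>R \<xi> k"

definition weight :: "real \<Rightarrow> real \<Rightarrow> 'a \<Rightarrow> (nat \<Rightarrow> 'a) \<Rightarrow> nat \<Rightarrow> real" where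
  "weight h R x \<xi> n = (\<Prod>k<n. accept h R (chain h x \<xi> k) (chain h x \<xi> (Suc k)))"

text \<open>State \<open>n\<close> reads the noise with indices below \<open>n\<close> only. This
  allows \<xi> to be changed at \<open>n\<close> when the last coordinate is integrated out, and to
  be restricted to \<open>{..<n}\<close> when a product measure is used.\<close>

lemma chain_cong: "(\<And>k. k < n \<Longrightarrow> \<xi> k = \<xi>' k) \<Longrightarrow> chain h x \<xi> n = chain h x \<xi>' n"
  by (induction n) auto

lemma weight_cong: "(\<And>k. k < n \<Longrightarrow> \<xi> k = \<xi>' k) \<Longrightarrow> weight h R x \<xi> n = weight h R x \<xi>' n"
  unfolding weight_def by (intro prod.cong refl arg_cong2[where f = "accept h R"] chain_cong) auto

lemma chain_measurable:
  assumes "\<And>k. k < n \<Longrightarrow> (\<lambda>\<omega>. \<xi> \<omega> k) \<in> borel_measurable M"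
  shows "(\<lambda>\<omega>. chain h x (\<xi> \<omega>) n) \<in> borel_measurable M"
  using assms
proof (induction n)
  case (Suc n)
  have [measurable]: "(\<lambda>\<omega>. chain h x (\<xi> \<omega>) n) \<in> borel_measurable M" "(\<lambda>\<omega>. \<xi> \<omega> n) \<in> borel_measurable M"
    using Suc by auto
  show ?case by simp
qed simp

lemma weight_measurable:
  assumes "\<And>k. k < n \<Longrightarrow> (\<lambda>\<omega>. \<xi> \<omega> k) \<in> borel_measurable M"
  shows "(\<lambda>\<omega>. weight h R x (\<xi> \<omega>) n) \<in> borel_measurable M"
  unfolding weight_def
proof (rule borel_measurable_prod)
  fix k assume "k \<in> {..<n}"
  then have [measurable]: "(\<lambda>\<omega>. chain h x (\<xi> \<omega>) k) \<in> borel_measurable M"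
    "(\<lambda>\<omega>. chain h x (\<xi> \<omega>) (Suc k)) \<in> borel_measurable M"
    using assms by (auto intro!: chain_measurable simp del: chain.simps)
  show "(\<lambda>\<omega>. accept h R (chain h x (\<xi> \<omega>) k) (chain h x (\<xi> \<omega>) (Suc k))) \<in> borel_measurable M"
    by measurable
qed

lemma weight_nonneg: "0 \<le> weight h R x \<xi> n" and weight_le_1: "weight h R x \<xi> n \<le> 1"
  unfolding weight_def by (auto intro!: prod_nonneg prod_le_1 accept_nonneg accept_le_1)

text \<open>A discrete Feynman-Kac formula. Integrating out the last increment replaces
  \<open>f\<close> by \<open>kernel h R f\<close> evaluated one step earlier; the induction
  therefore peels steps off the end and generalises \<open>f\<close>.\<close>

lemma nn_integral_chain:
  assumes h: "h > 0" and f: "f \<in> borel_measurable borel"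
  shows "(\<integral>\<^sup>+\<xi>. ennreal (weight h R x \<xi> n) * f (chain h x \<xi> n)
     \<partial>PiM {..<n} (\<lambda>_. density lborel (\<lambda>y. ennreal (gauss (sqrt h) y)))) = (kernel h R ^^ n) f x"
  using f
proof (induction n arbitrary: f)
  case 0
  show ?case by (simp add: nn_integral_empty PiM_empty weight_def)
next
  case (Suc n)
  note [measurable] = Suc.prems
  let ?\<gamma> = "density lborel (\<lambda>y::'a. ennreal (gauss (sqrt h) y))"
  interpret \<gamma>: prob_space ?\<gamma> using h by (intro prob_space_gauss) simp
  interpret P: product_sigma_finite "\<lambda>_::nat. ?\<gamma>" ..
  have comp: "(\<lambda>\<xi>. \<xi> k) \<in> borel_measurable (PiM {..<Suc n} (\<lambda>_. ?\<gamma>))" if "k < Suc n" for k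
    using measurable_component_singleton[of k "{..<Suc n}" "\<lambda>_. ?\<gamma>"] that by simp
  have [measurable]: "(\<lambda>\<xi>. weight h R x \<xi> (Suc n)) \<in> borel_measurable (PiM {..<Suc n} (\<lambda>_. ?\<gamma>))"
    "(\<lambda>\<xi>. chain h x \<xi> (Suc n)) \<in> borel_measurable (PiM {..<Suc n} (\<lambda>_. ?\<gamma>))"
    using comp by (intro weight_measurable chain_measurable; simp)+
  have step: "(\<integral>\<^sup>+y. ennreal (weight h R x (\<xi>(n := y)) (Suc n)) * f (chain h x (\<xi>(n := y)) (Suc n)) \<partial>?\<gamma>) =
      ennreal (weight h R x \<xi> n) * kernel h R f (chain h x \<xi> n)" for \<xi>
  proof -
    let ?z = "chain h x \<xi> n"
    let ?c = "?z - h *\<^sub>R G ?z"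
    let ?F = "\<lambda>y. ennreal (accept h R ?z y) * f y"
    have w: "weight h R x (\<xi>(n := y)) n = weight h R x \<xi> n" and c: "chain h x (\<xi>(n := y)) n = ?z" for y
      by (auto intro: weight_cong chain_cong)
    have "(\<integral>\<^sup>+y. ennreal (weight h R x (\<xi>(n := y)) (Suc n)) * f (chain h x (\<xi>(n := y)) (Suc n)) \<partial>?\<gamma>) =
       (\<integral>\<^sup>+y. ennreal (weight h R x \<xi> n) * ?F (?c + \<sigma> *\<^sub>R y) \<partial>?\<gamma>)"
      using w by (intro nn_integral_cong)
        (simp add: weight_def c ennreal_mult accept_nonneg prod_nonneg mult.assoc)
    also have "\<dots> = ennreal (weight h R x \<xi> n) * (\<integral>\<^sup>+y. ?F (?c + \<sigma> *\<^sub>R y) \<partial>?\<gamma>)"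
      by (rule nn_integral_cmult) measurable
    also have "(\<integral>\<^sup>+y. ?F (?c + \<sigma> *\<^sub>R y) \<partial>?\<gamma>) = (\<integral>\<^sup>+y. ?F (?c + \<sigma> *\<^sub>R y) * ennreal (gauss (sqrt h) y) \<partial>lborel)"
      by (subst nn_integral_density) (simp_all add: mult_ac)
    also have "\<dots> = (\<integral>\<^sup>+z. ?F z * ennreal (gauss (\<sigma> * sqrt h) (z - ?c)) \<partial>lborel)"
      using \<sigma> h by (intro nn_integral_gauss_affine) auto
    also have "\<dots> = kernel h R f ?z"
      unfolding kernel_def euler_density_def
      by (intro nn_integral_cong) (simp add: ennreal_mult accept_nonneg mult_ac)
    finally show ?thesis .
  qed
  have ins: "{..<Suc n} = insert n {..<n}" by auto
  have "(\<integral>\<^sup>+\<xi>. ennreal (weight h R x \<xi> (Suc n)) * f (chain h x \<xi> (Suc n)) \<partial>PiM {..<Suc n} (\<lambda>_. ?\<gamma>)) =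
     (\<integral>\<^sup>+\<xi>. (\<integral>\<^sup>+y. ennreal (weight h R x (\<xi>(n := y)) (Suc n)) * f (chain h x (\<xi>(n := y)) (Suc n)) \<partial>?\<gamma>)
       \<partial>PiM {..<n} (\<lambda>_. ?\<gamma>))"
    unfolding ins by (rule P.product_nn_integral_insert) (simp_all add: ins[symmetric] del: chain.simps)
  also have "\<dots> = (kernel h R ^^ n) (kernel h R f) x"
    unfolding step by (rule Suc.IH) measurable
  finally show ?case by (simp only: funpow_Suc_right o_apply)
qed

subsection \<open>Convergence of the chain\<close>

lemma G_lipschitz:
  obtains L where "L \<ge> 0" "\<And>x y. x \<in> cball 0 R \<Longrightarrow> y \<in> cball 0 R \<Longrightarrow> norm (G y - G x) \<le> L * norm (y - x)"
proof -
  obtain L where L: "\<And>x y. x \<in> cball 0 R \<Longrightarrow> y \<in> cball 0 R \<Longrightarrow> norm (G y - G x) \<le> L * norm (y - x)"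
    using potential unfolding regular_potential_def by meson
  show ?thesis
  proof (rule that)
    fix x y :: 'a assume xy: "x \<in> cball 0 R" "y \<in> cball 0 R"
    show "norm (G y - G x) \<le> \<bar>L\<bar> * norm (y - x)"
      using L[OF xy] mult_right_mono[OF abs_ge_self[of L] norm_ge_zero[of "y - x"]] by linarith
  qed simp
qed

lemma G_bounded:
  obtains b where "b \<ge> 0" "\<And>x. x \<in> cball 0 R \<Longrightarrow> norm (G x) \<le> b"
proof -
  have "bounded (G ` cball 0 R)"
    using regular_potential_continuous(1)[OF potential]
    by (intro compact_imp_bounded compact_continuous_image) (auto intro: continuous_on_subset)
  then obtain b where "b > 0" "\<And>x. x \<in> cball 0 R \<Longrightarrow> norm (G x) \<le> b"
    unfolding bounded_pos by auto
  then show ?thesis by (intro that[of b]) auto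
qed

text \<open>The first part of \<open>defect\<close> is the trapezoidal error. For the second, the
  difference of squares factors into a difference, controlled by the Lipschitz bound, and a sum,
  controlled by the bound on \<open>G\<close>. The constant depends on the ball but not on
  \<open>h\<close>.\<close>

lemma defect_bound:
  obtains C where "C \<ge> 0" "\<And>h x y. h > 0 \<Longrightarrow> x \<in> cball 0 R \<Longrightarrow> y \<in> cball 0 R \<Longrightarrow>
    \<bar>defect h x y\<bar> \<le> C * (norm (y - x) ^ 3 + h * norm (y - x))"
proof -
  obtain L where L: "L \<ge> 0" "\<And>x y. x \<in> cball 0 R \<Longrightarrow> y \<in> cball 0 R \<Longrightarrow> norm (G y - G x) \<le> L * norm (y - x)"
    using G_lipschitz[of R] by blast
  obtain b where b: "b \<ge> 0" "\<And>x. x \<in> cball 0 R \<Longrightarrow> norm (G x) \<le> b"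
    using G_bounded[of R] by blast
  obtain C where C: "\<And>x y. x \<in> cball 0 R \<Longrightarrow> y \<in> cball 0 R \<Longrightarrow>
      \<bar>\<Phi> y - \<Phi> x - (y - x) \<bullet> (G x + G y) / 2\<bar> \<le> C * norm (y - x) ^ 3"
    using potential unfolding regular_potential_def by meson
  let ?K = "2 / \<sigma>\<^sup>2 * \<bar>C\<bar> + 1 / (2 * \<sigma>\<^sup>2) * (2 * b * L)"
  show ?thesis
  proof (rule that)
    show "?K \<ge> 0" using L b by simp
    fix h :: real and x y :: 'a
    assume h: "h > 0" and xy: "x \<in> cball 0 R" "y \<in> cball 0 R"
    have 1: "\<bar>2 / \<sigma>\<^sup>2 * (\<Phi> y - \<Phi> x - (y - x) \<bullet> (G x + G y) / 2)\<bar> \<le> 2 / \<sigma>\<^sup>2 * (\<bar>C\<bar> * norm (y - x) ^ 3)"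
      unfolding abs_mult
      using order_trans[OF C[OF xy] mult_right_mono[OF abs_ge_self[of C], of "norm (y - x) ^ 3"]]
      by (intro mult_mono) auto
    have "\<bar>norm (G y) - norm (G x)\<bar> * \<bar>norm (G y) + norm (G x)\<bar> \<le> (L * norm (y - x)) * (2 * b)"
      using L(2)[OF xy] norm_triangle_ineq3[of "G y" "G x"] b(2)[OF xy(1)] b(2)[OF xy(2)] L(1)
      by (intro mult_mono) auto
    then have "\<bar>(norm (G y))\<^sup>2 - (norm (G x))\<^sup>2\<bar> \<le> (L * norm (y - x)) * (2 * b)"
      unfolding abs_mult[symmetric] by (simp add: power2_eq_square algebra_simps)
    then have 2: "\<bar>h / (2 * \<sigma>\<^sup>2) * ((norm (G y))\<^sup>2 - (norm (G x))\<^sup>2)\<bar> \<le> h / (2 * \<sigma>\<^sup>2) * ((L * norm (y - x)) * (2 * b))"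
      unfolding abs_mult using h by (intro mult_mono) auto
    have "\<bar>defect h x y\<bar> \<le> 2 / \<sigma>\<^sup>2 * \<bar>C\<bar> * norm (y - x) ^ 3 + 1 / (2 * \<sigma>\<^sup>2) * (2 * b * L) * (h * norm (y - x))"
      unfolding defect_def using order_trans[OF abs_triangle_ineq add_mono[OF 1 2]]
      by (simp add: mult_ac)
    also have "\<dots> \<le> ?K * norm (y - x) ^ 3 + ?K * (h * norm (y - x))"
      using L(1) b(1) h by (intro add_mono mult_right_mono) auto
    finally show "\<bar>defect h x y\<bar> \<le> ?K * (norm (y - x) ^ 3 + h * norm (y - x))"
      by (simp add: distrib_left)
  qed
qed

text \<open>The union bound: some move is rejected with probability at most the sum of the rejection
  probabilities.\<close>

lemma weight_ge: "1 - weight h R x \<xi> n \<le> (\<Sum>k<n. 1 - accept h R (chain h x \<xi> k) (chain h x \<xi> (Suc k)))"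
proof (induction n)
  case (Suc n)
  let ?a = "accept h R (chain h x \<xi> n) (chain h x \<xi> (Suc n))"
  have "weight h R x \<xi> n * (1 - ?a) \<le> 1 - ?a"
    using weight_le_1[of h R x \<xi> n] accept_le_1[of h R "chain h x \<xi> n" "chain h x \<xi> (Suc n)"]
    by (intro mult_left_le_one_le weight_nonneg) auto
  moreover have "weight h R x \<xi> (Suc n) = weight h R x \<xi> n * ?a"
    by (simp add: weight_def)
  ultimately show ?case using Suc by (simp add: right_diff_distrib)
qed (simp add: weight_def)

text \<open>One rejection probability is at most the absolute defect, by
  \<open>1 - exp (- a) \<le> a\<close>. The displacement is then replaced by the noise increment
  plus a drift of size at most \<open>h * b\<close>, so that only third moments of the noise remain
  to be estimated.\<close>

lemma weight_defect_bound:
  obtains C where "C \<ge> 0" "\<And>h x \<xi> n. h > 0 \<Longrightarrow> (\<And>k. k \<le> n \<Longrightarrow> chain h x \<xi> k \<in> cball 0 R) \<Longrightarrow>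
    1 - weight h R x \<xi> n \<le> (\<Sum>k<n. C * (h * sqrt h + h ^ 3 + norm (\<xi> k) ^ 3))"
proof -
  obtain b where b: "b \<ge> 0" "\<And>x. x \<in> cball 0 R \<Longrightarrow> norm (G x) \<le> b"
    using G_bounded[of R] by blast
  obtain C where C: "C \<ge> 0" "\<And>h x y. h > 0 \<Longrightarrow> x \<in> cball 0 R \<Longrightarrow> y \<in> cball 0 R \<Longrightarrow>
    \<bar>defect h x y\<bar> \<le> C * (norm (y - x) ^ 3 + h * norm (y - x))"
    using defect_bound[of R] by blast
  \<comment> \<open>Each 8 is 2 from \<open>2 * D ^ 3\<close> times 4 from the cube of a sum; the 1
    covers the term \<open>h * sqrt h\<close>.\<close>
  define B where "B = 1 + 8 * b ^ 3 + 8 * \<sigma> ^ 3"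
  have B: "1 \<le> B" "8 * b ^ 3 \<le> B" "8 * \<sigma> ^ 3 \<le> B"
    using b(1) \<sigma> by (auto simp: B_def)
  show ?thesis
  proof (rule that)
    show "0 \<le> C * B" using C(1) B(1) by simp
    fix h x \<xi> n
    assume h: "h > (0::real)" and ball: "\<And>k. k \<le> n \<Longrightarrow> chain h x \<xi> k \<in> cball 0 R"
    have "1 - accept h R (chain h x \<xi> k) (chain h x \<xi> (Suc k))
        \<le> C * B * (h * sqrt h + h ^ 3 + norm (\<xi> k) ^ 3)" if k: "k < n" for k
    proof -
      let ?x = "chain h x \<xi> k" and ?y = "chain h x \<xi> (Suc k)"
      have xy: "?x \<in> cball 0 R" "?y \<in> cball 0 R"
        using k by (intro ball; simp)+
      define D where "D = norm (?y - ?x)"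
      have D0: "0 \<le> D" by (simp add: D_def)
      have "1 - accept h R ?x ?y \<le> \<bar>defect h ?x ?y\<bar>"
        using xy exp_ge_add_one_self[of "- defect h ?x ?y"] by (auto simp: accept_def simp del: chain.simps)
      also have "\<dots> \<le> C * (D ^ 3 + h * D)"
        unfolding D_def by (rule C(2)[OF h xy])
      also have "\<dots> \<le> C * (2 * D ^ 3 + h * sqrt h)"
      proof (rule mult_left_mono[OF _ C(1)])
        \<comment> \<open>The mixed term is absorbed by comparing the displacement with its typical
          size: it is at most \<open>h * sqrt h\<close> if \<open>D \<le> sqrt h\<close>, and at
          most \<open>D ^ 3\<close> otherwise.\<close>
        have "h * D \<le> D ^ 3 + h * sqrt h"
        proof (cases "D \<le> sqrt h")
          case True
          then show ?thesis using mult_left_mono[OF True, of h] h D0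
            by (smt (verit) zero_le_power)
        next
          case False
          then have "(sqrt h)\<^sup>2 \<le> D\<^sup>2" using h by (intro power_mono) auto
          then have "h * D \<le> D\<^sup>2 * D" using h D0 by (intro mult_right_mono) auto
          then show ?thesis using h by (simp add: power2_eq_square power3_eq_cube) (smt (verit) mult_nonneg_nonneg real_sqrt_ge_zero)
        qed
        then show "D ^ 3 + h * D \<le> 2 * D ^ 3 + h * sqrt h" by simp
      qed
      also have "\<dots> \<le> C * (B * (h * sqrt h + h ^ 3 + norm (\<xi> k) ^ 3))"
      proof (rule mult_left_mono[OF _ C(1)])
        have "D \<le> h * b + \<sigma> * norm (\<xi> k)"
        proof -
          have "?y - ?x = \<sigma> *\<^sub>R \<xi> k - h *\<^sub>R G ?x" by simp
          then have "D \<le> norm (\<sigma> *\<^sub>R \<xi> k) + norm (h *\<^sub>R G ?x)"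
            unfolding D_def by (metis norm_triangle_ineq4)
          also have "\<dots> \<le> \<sigma> * norm (\<xi> k) + h * b"
            using \<sigma> h b(2)[OF xy(1)] by simp
          finally show ?thesis by simp
        qed
        then have "D ^ 3 \<le> (h * b + \<sigma> * norm (\<xi> k)) ^ 3"
          using D0 by (rule power_mono)
        also have "\<dots> \<le> 4 * (h * b) ^ 3 + 4 * (\<sigma> * norm (\<xi> k)) ^ 3"
        proof -
          have cube: "(u + v) ^ 3 \<le> 4 * u ^ 3 + 4 * v ^ 3" if "u \<ge> 0" "v \<ge> 0" for u v :: real
          proof -
            \<comment> \<open>This quantity is exactly the right-hand side minus the left-hand
              side.\<close>
            have "0 \<le> 3 * ((u + v) * (u - v)\<^sup>2)" using that by simp
            then show ?thesis by (simp add: power2_eq_square power3_eq_cube algebra_simps)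
          qed
          show ?thesis using h b(1) \<sigma> by (intro cube) auto
        qed
        finally have "2 * D ^ 3 + h * sqrt h \<le> h * sqrt h + 8 * b ^ 3 * h ^ 3 + 8 * \<sigma> ^ 3 * norm (\<xi> k) ^ 3"
          by (simp add: power_mult_distrib algebra_simps)
        also have "\<dots> \<le> B * (h * sqrt h) + B * h ^ 3 + B * norm (\<xi> k) ^ 3"
          using B h mult_right_mono[OF B(1), of "h * sqrt h"] by (intro add_mono mult_right_mono) auto
        finally show "2 * D ^ 3 + h * sqrt h \<le> B * (h * sqrt h + h ^ 3 + norm (\<xi> k) ^ 3)"
          by (simp add: distrib_left)
      qed
      finally show ?thesis by (simp add: mult.assoc)
    qed
    then show "1 - weight h R x \<xi> n \<le> (\<Sum>k<n. C * B * (h * sqrt h + h ^ 3 + norm (\<xi> k) ^ 3))"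
      using weight_ge[of h R x \<xi> n] by (smt (verit) sum_mono lessThan_iff)
  qed
qed

text \<open>A statement about a single path. The noise enters chain and solution through the same
  increments and cancels in their difference; what remains is the variation of
  \<open>G (Y s)\<close> within a step, small by uniform continuity of \<open>Y\<close>, and a
  discrete Gronwall argument. The radius \<open>r\<close> depends on the path but neither on
  \<epsilon> nor on the number of steps.\<close>

lemma euler_converges:
  fixes Y W :: "real \<Rightarrow> 'a"
  assumes t: "t > 0" and cont: "continuous_on {0..t} Y" and W0: "W 0 = 0"
    and int: "\<And>s. s \<in> {0..t} \<Longrightarrow> ((\<lambda>r. - G (Y r)) has_integral (Y s - x - \<sigma> *\<^sub>R W s)) {0..s}"
  defines "\<xi> \<equiv> \<lambda>n k. W (real (Suc k) * (t / real n)) - W (real k * (t / real n))"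
  obtains r where "\<And>\<epsilon>. \<epsilon> > 0 \<Longrightarrow> \<exists>n0>0. \<forall>n\<ge>n0. (\<forall>k\<le>n. norm (chain (t / real n) x (\<xi> n) k) \<le> r) \<and>
     norm (chain (t / real n) x (\<xi> n) n - Y t) \<le> \<epsilon>"
proof -
  have "bounded (Y ` {0..t})"
    using cont by (intro compact_imp_bounded compact_continuous_image) auto
  then obtain r where r: "\<And>s. s \<in> {0..t} \<Longrightarrow> norm (Y s) \<le> r"
    unfolding bounded_iff by blast
  obtain L where L: "L \<ge> 0"
    "\<And>x y. x \<in> cball 0 (r + 1) \<Longrightarrow> y \<in> cball 0 (r + 1) \<Longrightarrow> norm (G y - G x) \<le> L * norm (y - x)"
    using G_lipschitz[of "r + 1"] by blast
  have Y0: "Y 0 = x"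
    using int[of 0] t W0 by (auto dest: has_integral_unique[OF has_integral_refl(2)])
  show ?thesis
  proof (rule that[of "r + 1"])
    fix \<epsilon> :: real assume "\<epsilon> > 0"
    \<comment> \<open>Division by \<open>exp (L * t)\<close> compensates the Gronwall factor. The
      minimum with 1 keeps the chain within distance 1 of \<open>Y\<close>, hence in the ball of
      radius \<open>r + 1\<close> for which \<open>L\<close> was chosen.\<close>
    define \<epsilon>' where "\<epsilon>' = min \<epsilon> 1 / exp (L * t)"
    have \<epsilon>': "\<epsilon>' > 0" "\<epsilon>' * exp (L * t) \<le> \<epsilon>" "\<epsilon>' * exp (L * t) \<le> 1"
      using \<open>\<epsilon> > 0\<close> by (auto simp: \<epsilon>'_def)
    have "uniformly_continuous_on {0..t} Y"
      using cont by (intro compact_uniformly_continuous) auto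
    then obtain \<delta> where \<delta>: "\<delta> > 0" "\<And>s s'. s \<in> {0..t} \<Longrightarrow> s' \<in> {0..t} \<Longrightarrow> dist s' s < \<delta> \<Longrightarrow> dist (Y s') (Y s) < \<epsilon>'"
      using \<epsilon>'(1) unfolding uniformly_continuous_on_def by metis
    obtain n0 where n0: "n0 > 0" "t / real n0 < \<delta>"
    proof -
      obtain n0 where "t / \<delta> < real n0" using reals_Archimedean2 by blast
      moreover from this have "n0 > 0" using t \<delta>(1)
        by (intro Nat.gr0I) (auto simp: field_simps)
      ultimately show ?thesis using t \<delta>(1) by (intro that[of n0]) (auto simp: field_simps)
    qed
    show "\<exists>n0>0. \<forall>n\<ge>n0. (\<forall>k\<le>n. norm (chain (t / real n) x (\<xi> n) k) \<le> r + 1) \<and>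
     norm (chain (t / real n) x (\<xi> n) n - Y t) \<le> \<epsilon>"
    proof (intro exI[of _ n0] conjI allI impI)
      show "n0 > 0" by (rule n0(1))
      fix n assume n: "n0 \<le> n"
      define h where "h = t / real n"
      have npos: "n > 0" using n n0 by simp
      have h: "h > 0" "h < \<delta>"
      proof -
        show "h > 0" using t npos by (simp add: h_def)
        have "h \<le> t / real n0" using n n0 t by (simp add: h_def frac_le)
        then show "h < \<delta>" using n0 by simp
      qed
      have nh: "real n * h = t" using npos by (simp add: h_def)
      have kh: "real k * h \<in> {0..t}" if "k \<le> n" for k
        using that h nh mult_right_mono[of "real k" "real n" h] by auto
      let ?Z = "chain h x (\<xi> n)"
      have growth: "\<epsilon>' * ((1 + h * L) ^ k - 1) \<le> \<epsilon>' * exp (L * t)" if k: "k \<le> n" for k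
      proof -
        have "(1 + h * L) ^ k \<le> exp (h * L) ^ k"
          using h L(1) by (intro power_mono exp_ge_add_one_self) auto
        also have "\<dots> = exp (real k * (h * L))" by (simp add: exp_of_nat_mult)
        also have "\<dots> \<le> exp (L * t)"
          using mult_right_mono[of "real k * h" t L] kh[OF k] L(1) by (simp add: mult_ac)
        finally show ?thesis using \<epsilon>'(1) by (intro mult_left_mono) auto
      qed
      \<comment> \<open>The right-hand side is the exact solution of
        \<open>e (Suc k) = (1 + h * L) * e k + L * \<epsilon>' * h\<close> with
        \<open>e 0 = 0\<close>.\<close>
      have err: "norm (?Z k - Y (real k * h)) \<le> \<epsilon>' * ((1 + h * L) ^ k - 1)" if "k \<le> n" for k
        using that
      proof (induction k)
        case 0
        then show ?case by (simp add: Y0)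
      next
        case (Suc k)
        let ?a = "real k * h" and ?b = "real (Suc k) * h"
        have ab: "?a \<in> {0..t}" "?b \<in> {0..t}" "?b - ?a = h" "?a \<le> ?b"
          using kh[of k] kh[of "Suc k"] Suc.prems h by (auto simp: algebra_simps)
        have IH: "norm (?Z k - Y ?a) \<le> \<epsilon>' * ((1 + h * L) ^ k - 1)" using Suc by simp
        \<comment> \<open>A bootstrap: the error bound at \<open>k\<close> is what places the chain
          in the ball, and so permits the Lipschitz estimate that gives the bound at
          \<open>Suc k\<close>.\<close>
        also have "\<dots> \<le> 1" using growth[of k] Suc.prems \<epsilon>'(3) by simp
        finally have Zball: "?Z k \<in> cball 0 (r + 1)"
          using r[OF ab(1)] norm_triangle_ineq[of "?Z k - Y ?a" "Y ?a"] by simp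
        have inta: "((\<lambda>s. - G (Y s)) has_integral (Y ?a - x - \<sigma> *\<^sub>R W ?a)) {0..?a}"
          and intb: "((\<lambda>s. - G (Y s)) has_integral (Y ?b - x - \<sigma> *\<^sub>R W ?b)) {0..?b}"
          using ab by (auto intro!: int)
        have iab: "(\<lambda>s. - G (Y s)) integrable_on {?a..?b}"
          by (rule integrable_on_subinterval[OF has_integral_integrable[OF intb]]) (use ab in auto)
        have "integral {0..?a} (\<lambda>s. - G (Y s)) + integral {?a..?b} (\<lambda>s. - G (Y s)) = integral {0..?b} (\<lambda>s. - G (Y s))"
          using ab by (intro Henstock_Kurzweil_Integration.integral_combine has_integral_integrable[OF intb]) auto
        then have "integral {?a..?b} (\<lambda>s. - G (Y s)) = Y ?b - Y ?a - \<sigma> *\<^sub>R (W ?b - W ?a)"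
          unfolding integral_unique[OF inta] integral_unique[OF intb] by (simp add: algebra_simps)
        with integrable_integral[OF iab]
        have "((\<lambda>s. - G (Y s)) has_integral (Y ?b - Y ?a - \<sigma> *\<^sub>R (W ?b - W ?a))) {?a..?b}" by simp
        moreover have "((\<lambda>s. - G (Y ?a)) has_integral (h *\<^sub>R - G (Y ?a))) {?a..?b}"
          using has_integral_const_real[of "- G (Y ?a)" ?a ?b] ab(3,4) by (simp add: measure_def)
        ultimately have diff: "((\<lambda>s. - G (Y s) - - G (Y ?a)) has_integral
            (Y ?b - Y ?a - \<sigma> *\<^sub>R (W ?b - W ?a) - h *\<^sub>R - G (Y ?a))) {?a..?b}"
          by (rule has_integral_diff)
        have "norm (Y ?b - Y ?a - \<sigma> *\<^sub>R (W ?b - W ?a) - h *\<^sub>R - G (Y ?a))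
            \<le> L * \<epsilon>' * measure lborel {?a..?b}"
        proof (rule has_integral_bound_real[OF _ finite.emptyI diff])
          show "0 \<le> L * \<epsilon>'" using L \<epsilon>' by simp
          fix s assume s: "s \<in> {?a..?b} - {}"
          have "0 \<le> ?a" "?a \<le> s" "s \<le> ?b" "?b \<le> t"
            using s ab(1,2) by simp_all
          then have st: "s \<in> {0..t}" "dist s ?a < \<delta>"
            using ab(3) h(2) unfolding dist_real_def atLeastAtMost_iff by linarith+
          have "norm (- G (Y s) - - G (Y ?a)) = norm (G (Y ?a) - G (Y s))" by (simp add: algebra_simps)
          also have "\<dots> \<le> L * norm (Y ?a - Y s)"
            using r[OF st(1)] r[OF ab(1)] by (intro L(2)) auto
          also have "\<dots> \<le> L * \<epsilon>'"
            using \<delta>(2)[OF ab(1) st] L(1) by (intro mult_left_mono) (auto simp: dist_norm norm_minus_commute)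
          finally show "norm (- G (Y s) - - G (Y ?a)) \<le> L * \<epsilon>'" .
        qed
        then have local: "norm (Y ?b - Y ?a - \<sigma> *\<^sub>R (W ?b - W ?a) + h *\<^sub>R G (Y ?a)) \<le> L * \<epsilon>' * h"
          using ab(3,4) by simp
        have \<xi>k: "\<xi> n k = W ?b - W ?a" unfolding \<xi>_def h_def ..
        \<comment> \<open>Old error, its propagation through the drift, and the local error of one
          step over which the drift is frozen at \<open>Y ?a\<close>.\<close>
        have "?Z (Suc k) - Y ?b = (?Z k - Y ?a) + h *\<^sub>R (G (Y ?a) - G (?Z k)) -
            (Y ?b - Y ?a - \<sigma> *\<^sub>R (W ?b - W ?a) + h *\<^sub>R G (Y ?a))"
          unfolding chain.simps \<xi>k by (simp add: scaleR_diff_right)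
        then have "norm (?Z (Suc k) - Y ?b) \<le> norm (?Z k - Y ?a) + norm (h *\<^sub>R (G (Y ?a) - G (?Z k))) +
            norm (Y ?b - Y ?a - \<sigma> *\<^sub>R (W ?b - W ?a) + h *\<^sub>R G (Y ?a))"
          by (metis norm_triangle_le_diff norm_triangle_ineq add_right_mono)
        also have "norm (h *\<^sub>R (G (Y ?a) - G (?Z k))) \<le> h * (L * norm (?Z k - Y ?a))"
          using L(2)[OF Zball, of "Y ?a"] r[OF ab(1)] h by (simp add: norm_minus_commute)
        finally have "norm (?Z (Suc k) - Y ?b) \<le> (1 + h * L) * norm (?Z k - Y ?a) + L * \<epsilon>' * h"
          using local by (simp add: algebra_simps)
        also have "\<dots> \<le> (1 + h * L) * (\<epsilon>' * ((1 + h * L) ^ k - 1)) + L * \<epsilon>' * h"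
          using IH h L(1) by (intro add_right_mono mult_left_mono) auto
        also have "\<dots> = \<epsilon>' * ((1 + h * L) ^ Suc k - 1)" by (simp add: algebra_simps)
        finally show ?case .
      qed
      show "norm (chain (t / real n) x (\<xi> n) k) \<le> r + 1" if "k \<le> n" for k
        using err[OF that] growth[OF that] \<epsilon>'(3) r[OF kh[OF that]]
          norm_triangle_ineq[of "?Z k - Y (real k * h)" "Y (real k * h)"]
        unfolding h_def[symmetric] by simp
      show "norm (chain (t / real n) x (\<xi> n) n - Y t) \<le> \<epsilon>"
        using err[of n] growth[of n] \<epsilon>'(2) unfolding h_def[symmetric] nh by simp
    qed
  qed
qed

end

section \<open>Increments of Brownian motion on a uniform grid\<close>

lemma brownian_increment_distr:
  fixes W :: "real \<Rightarrow> 'w \<Rightarrow> 'a::euclidean_space"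
  assumes W: "brownian_motion M W" and h: "h > 0"
  shows "distr M borel (\<lambda>\<omega>. W (real (Suc k) * h) \<omega> - W (real k * h) \<omega>) =
    density lborel (\<lambda>y. ennreal (gauss (sqrt h) y))"
proof -
  have "\<forall>r s. 0 \<le> r \<longrightarrow> r < s \<longrightarrow> distr M borel (\<lambda>\<omega>. W s \<omega> - W r \<omega>) =
      density lborel (\<lambda>x. ennreal (\<Prod>e\<in>Basis. normal_density 0 (sqrt (s - r)) (x \<bullet> e)))"
    using W by (simp add: brownian_motion_def)
  moreover have "real (Suc k) * h - real k * h = h" by (simp add: algebra_simps)
  ultimately show ?thesis
    using h by (simp add: gauss_def)
qed

text \<open>Independence along the monotone grid \<open>k * h\<close> turns the marginal laws into a
  product law, so that the noise of the solution can replace the abstract product space of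
  \<open>nn_integral_chain\<close>.\<close>

lemma brownian_increments_distr:
  fixes W :: "real \<Rightarrow> 'w \<Rightarrow> 'a::euclidean_space"
  assumes W: "brownian_motion M W" and h: "h > 0" and n: "n > 0"
  shows "distr M (PiM {..<n} (\<lambda>_. borel)) (\<lambda>\<omega>. \<lambda>k\<in>{..<n}. W (real (Suc k) * h) \<omega> - W (real k * h) \<omega>) =
    PiM {..<n} (\<lambda>_. density lborel (\<lambda>y. ennreal (gauss (sqrt h) y)))"
proof -
  interpret prob_space M using W by (simp add: brownian_motion_def)
  have W_measurable: "W s \<in> borel_measurable M" if "s \<ge> 0" for s
    using W that by (simp add: brownian_motion_def)
  let ?\<xi> = "\<lambda>k \<omega>. W (real (Suc k) * h) \<omega> - W (real k * h) \<omega>"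
  have "mono (\<lambda>k. real k * h)"
    using h by (intro monoI mult_right_mono) auto
  then have ind: "indep_vars (\<lambda>_. borel) ?\<xi> {..<n}"
    using W h unfolding brownian_motion_def
    by (elim conjE allE[where x = n] allE[where x = "\<lambda>k. real k * h"]) simp
  have rv: "?\<xi> k \<in> borel_measurable M" for k
    using h by (intro borel_measurable_diff W_measurable) auto
  \<comment> \<open>The characterisation of independence by the product law is used for a nonempty
    index set, hence the assumption \<open>n > 0\<close>.\<close>
  have "{..<n} \<noteq> {}" using n by auto
  from indep_vars_iff_distr_eq_PiM[where M' = "\<lambda>_. borel" and X = ?\<xi>, OF this rv] ind
  show ?thesis by (simp only: brownian_increment_distr[OF W h])
qed

text \<open>The Gaussian moment with standard deviation \<open>sqrt h\<close>. The constant involves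
  the dimension only, so it can be fixed before the starting point and the Brownian motion.\<close>

lemma brownian_increment_cube:
  fixes W :: "real \<Rightarrow> 'w \<Rightarrow> 'a::euclidean_space"
  assumes W: "brownian_motion M W" and h: "h > 0"
  defines "c \<equiv> real DIM('a) ^ 4 * 2 * sqrt (2 / pi)"
  shows "integrable M (\<lambda>\<omega>. norm (W (real (Suc k) * h) \<omega> - W (real k * h) \<omega>) ^ 3)"
    and "(LINT \<omega>|M. norm (W (real (Suc k) * h) \<omega> - W (real k * h) \<omega>) ^ 3) \<le> c * (h * sqrt h)"
proof -
  have W_measurable: "W s \<in> borel_measurable M" if "s \<ge> 0" for s
    using W that by (simp add: brownian_motion_def)
  let ?\<xi> = "\<lambda>\<omega>. W (real (Suc k) * h) \<omega> - W (real k * h) \<omega>"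
  have [measurable]: "?\<xi> \<in> borel_measurable M"
    using h by (intro borel_measurable_diff W_measurable) auto
  note distr = brownian_increment_distr[OF W h, of k]
  have "(\<integral>\<^sup>+\<omega>. ennreal (norm (?\<xi> \<omega>) ^ 3) \<partial>M) = (\<integral>\<^sup>+y. ennreal (norm y ^ 3) \<partial>distr M borel ?\<xi>)"
    by (subst nn_integral_distr) (simp_all del: of_nat_Suc)
  also have "\<dots> = (\<integral>\<^sup>+y. ennreal (gauss (sqrt h) y * norm (y::'a) ^ 3) \<partial>lborel)"
    unfolding distr by (subst nn_integral_density) (simp_all add: ennreal_mult)
  also have "\<dots> \<le> ennreal (c * sqrt h ^ 3)"
    unfolding c_def using h by (intro nn_integral_gauss_norm_cube) simp
  also have "sqrt h ^ 3 = h * sqrt h"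
    using h by (simp add: power3_eq_cube)
  finally have le: "(\<integral>\<^sup>+\<omega>. ennreal (norm (?\<xi> \<omega>) ^ 3) \<partial>M) \<le> ennreal (c * (h * sqrt h))" .
  show int: "integrable M (\<lambda>\<omega>. norm (?\<xi> \<omega>) ^ 3)"
  proof (rule integrableI_nonneg)
    show "(\<integral>\<^sup>+\<omega>. ennreal (norm (?\<xi> \<omega>) ^ 3) \<partial>M) < \<infinity>"
      using le by (rule le_less_trans) simp
  qed (simp_all del: of_nat_Suc)
  have "0 \<le> c * (h * sqrt h)" using h by (simp add: c_def)
  then show "(LINT \<omega>|M. norm (?\<xi> \<omega>) ^ 3) \<le> c * (h * sqrt h)"
    using le by (subst (asm) nn_integral_eq_integral[OF int]) auto
qed

section \<open>Convergence of the kernel powers to the law of the solution\<close>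

context langevin
begin

text \<open>The kernel power is deterministic, so any Brownian motion may represent it. Taking the
  one that drives the solution couples chain and solution on the same space, which makes pathwise
  convergence usable.\<close>

lemma kernel_pow_eq_expectation:
  fixes W :: "real \<Rightarrow> 'w \<Rightarrow> 'a"
  assumes W: "brownian_motion M W" and h: "h > 0" and n: "n > 0"
    and [measurable]: "f \<in> borel_measurable borel"
  defines "\<xi> \<equiv> \<lambda>\<omega> k. W (real (Suc k) * h) \<omega> - W (real k * h) \<omega>"
  shows "(kernel h R ^^ n) f x = (\<integral>\<^sup>+\<omega>. ennreal (weight h R x (\<xi> \<omega>) n) * f (chain h x (\<xi> \<omega>) n) \<partial>M)"
proof -
  have \<xi>: "(\<lambda>\<omega>. \<xi> \<omega> k) \<in> borel_measurable M" for k
    using W h unfolding brownian_motion_def \<xi>_def by (intro borel_measurable_diff) auto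
  let ?P = "PiM {..<n} (\<lambda>_. borel :: 'a measure)"
  have comp: "(\<lambda>\<xi>. \<xi> k) \<in> borel_measurable ?P" if "k < n" for k
    using that by simp
  have [measurable]: "(\<lambda>\<xi>. weight h R x \<xi> n) \<in> borel_measurable ?P" "(\<lambda>\<xi>. chain h x \<xi> n) \<in> borel_measurable ?P"
    using comp by (intro weight_measurable chain_measurable; simp)+
  have res: "(\<lambda>\<omega>. \<lambda>k\<in>{..<n}. \<xi> \<omega> k) \<in> measurable M ?P"
    using \<xi> by (intro measurable_restrict)
  have "(kernel h R ^^ n) f x = (\<integral>\<^sup>+\<xi>. ennreal (weight h R x \<xi> n) * f (chain h x \<xi> n)
       \<partial>distr M ?P (\<lambda>\<omega>. \<lambda>k\<in>{..<n}. \<xi> \<omega> k))"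
    unfolding \<xi>_def brownian_increments_distr[OF W h n] by (rule nn_integral_chain[symmetric]) fact+
  also have "\<dots> = (\<integral>\<^sup>+\<omega>. ennreal (weight h R x (\<lambda>k\<in>{..<n}. \<xi> \<omega> k) n) * f (chain h x (\<lambda>k\<in>{..<n}. \<xi> \<omega> k) n) \<partial>M)"
    using res by (rule nn_integral_distr) measurable
  also have "\<dots> = (\<integral>\<^sup>+\<omega>. ennreal (weight h R x (\<xi> \<omega>) n) * f (chain h x (\<xi> \<omega>) n) \<partial>M)"
  proof (rule nn_integral_cong)
    fix \<omega>
    have "weight h R x (\<lambda>k\<in>{..<n}. \<xi> \<omega> k) n = weight h R x (\<xi> \<omega>) n"
      "chain h x (\<lambda>k\<in>{..<n}. \<xi> \<omega> k) n = chain h x (\<xi> \<omega>) n"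
      by (auto intro: weight_cong chain_cong)
    then show "ennreal (weight h R x (\<lambda>k\<in>{..<n}. \<xi> \<omega> k) n) * f (chain h x (\<lambda>k\<in>{..<n}. \<xi> \<omega> k) n) =
      ennreal (weight h R x (\<xi> \<omega>) n) * f (chain h x (\<xi> \<omega>) n)" by simp
  qed
  finally show ?thesis .
qed

text \<open>The weights are at most 1 and the noise has a probability law. This sub-Markov bound,
  uniform in \<open>n\<close> and \<open>x\<close>, supplies the dominating function in the later
  limit.\<close>

lemma kernel_pow_le:
  assumes h: "h > 0" and f: "f \<in> borel_measurable borel" and B: "\<And>z. f z \<le> B"
  shows "(kernel h R ^^ n) f x \<le> B"
proof -
  let ?\<gamma> = "density lborel (\<lambda>y::'a. ennreal (gauss (sqrt h) y))"
  interpret \<gamma>: prob_space ?\<gamma> using h by (intro prob_space_gauss) simp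
  interpret P: prob_space "PiM {..<n} (\<lambda>_. ?\<gamma>)"
    by (rule prob_space_PiM) (rule \<gamma>.prob_space_axioms)
  have "(kernel h R ^^ n) f x \<le> (\<integral>\<^sup>+\<xi>. B \<partial>PiM {..<n} (\<lambda>_. ?\<gamma>))"
    unfolding nn_integral_chain[OF h f, symmetric]
  proof (rule nn_integral_mono)
    fix \<xi>
    show "ennreal (weight h R x \<xi> n) * f (chain h x \<xi> n) \<le> B"
      using mult_mono[of "ennreal (weight h R x \<xi> n)" 1, OF _ B] weight_le_1 by simp
  qed
  then show ?thesis by (simp add: P.emeasure_space_1)
qed

text \<open>The number of Euler steps is chosen so large, in dependence on the radius \<open>m\<close> of the
  cut-off, that the expected total rejection probability inside the ball is at most \<open>1 / (m + 1)\<close>.\<close>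

lemma step_numbers:
  assumes t: "t > 0" and c: "c \<ge> 0"
  obtains N :: "nat \<Rightarrow> nat" and C :: "nat \<Rightarrow> real" where "\<And>m. N m > m" "\<And>m. C m \<ge> 0"
    "\<And>m h x \<xi> n. h > 0 \<Longrightarrow> (\<And>k. k \<le> n \<Longrightarrow> chain h x \<xi> k \<in> cball 0 (real m)) \<Longrightarrow>
       1 - weight h (real m) x \<xi> n \<le> (\<Sum>k<n. C m * (h * sqrt h + h ^ 3 + norm (\<xi> k) ^ 3))"
    "\<And>m. let h = t / real (N m) in
       real (N m) * (C m * (h * sqrt h + h ^ 3 + c * (h * sqrt h))) \<le> 1 / real (Suc m)"
proof -
  have "\<exists>C\<ge>0. \<forall>h>0. \<forall>x \<xi> n. (\<forall>k\<le>n. chain h x \<xi> k \<in> cball 0 (real m)) \<longrightarrow>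
       1 - weight h (real m) x \<xi> n \<le> (\<Sum>k<n. C * (h * sqrt h + h ^ 3 + norm (\<xi> k) ^ 3))" for m
    using weight_defect_bound[of "real m"] by metis
  then obtain C where C: "\<And>m. C m \<ge> 0" "\<And>m h x \<xi> n. h > 0 \<Longrightarrow>
      (\<And>k. k \<le> n \<Longrightarrow> chain h x \<xi> k \<in> cball 0 (real m)) \<Longrightarrow>
       1 - weight h (real m) x \<xi> n \<le> (\<Sum>k<n. C m * (h * sqrt h + h ^ 3 + norm (\<xi> k) ^ 3))"
    by metis
  have "\<exists>n>m. real n * (C m * (t / real n * sqrt (t / real n) + (t / real n) ^ 3 + c * (t / real n * sqrt (t / real n))))
      \<le> 1 / real (Suc m)" for m
  proof -
    let ?h = "\<lambda>n. t / real n"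
    have h0: "?h \<longlonglongrightarrow> 0" by (rule lim_const_over_n)
    \<comment> \<open>This is the total bound after \<open>real n * h = t\<close> has been inserted;
      with \<open>C m\<close> fixed, every term carries a positive power of the step.\<close>
    have "(\<lambda>n. C m * (t * sqrt (?h n) + t * ?h n ^ 2 + c * (t * sqrt (?h n)))) \<longlonglongrightarrow>
       C m * (t * sqrt 0 + t * 0 ^ 2 + c * (t * sqrt 0))"
      by (intro tendsto_intros h0)
    then have "eventually (\<lambda>n. C m * (t * sqrt (?h n) + t * ?h n ^ 2 + c * (t * sqrt (?h n))) < 1 / real (Suc m)) sequentially"
      by (rule order_tendstoD) simp
    moreover have "eventually (\<lambda>n. n > m) sequentially" by (rule eventually_gt_at_top)
    ultimately have "eventually (\<lambda>n. n > m \<and> C m * (t * sqrt (?h n) + t * ?h n ^ 2 + c * (t * sqrt (?h n))) < 1 / real (Suc m)) sequentially"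
      by eventually_elim simp
    then obtain n where n: "n > m" "C m * (t * sqrt (?h n) + t * ?h n ^ 2 + c * (t * sqrt (?h n))) < 1 / real (Suc m)"
      using eventually_happens'[OF sequentially_bot] by blast
    have nh: "real n * ?h n = t" using n(1) by simp
    have "real n * (C m * (?h n * sqrt (?h n) + ?h n ^ 3 + c * (?h n * sqrt (?h n)))) =
       C m * ((real n * ?h n) * sqrt (?h n) + (real n * ?h n) * ?h n ^ 2 + c * ((real n * ?h n) * sqrt (?h n)))"
      by (simp only: power3_eq_cube power2_eq_square distrib_left mult_ac)
    also have "\<dots> \<le> 1 / real (Suc m)" unfolding nh using n(2) by simp
    finally show ?thesis using n(1) by blast
  qed
  then obtain N where N: "\<And>m. N m > m" "\<And>m. real (N m) * (C m * (t / real (N m) * sqrt (t / real (N m)) +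
      (t / real (N m)) ^ 3 + c * (t / real (N m) * sqrt (t / real (N m))))) \<le> 1 / real (Suc m)"
    by metis
  show ?thesis
    by (rule that[of N C]) (use N C in \<open>auto simp: Let_def\<close>)
qed

text \<open>\<open>N\<close> and \<open>C\<close> are given, not obtained, so that the same kernels
  serve all starting points and all solutions. The error has a part that vanishes along almost every
  path and is bounded, treated by dominated convergence, and the expected rejection inside the ball,
  treated by the choice of \<open>N\<close>.\<close>

lemma kernel_pow_tendsto:
  fixes W :: "real \<Rightarrow> 'w \<Rightarrow> 'a" and f :: "'a \<Rightarrow> real"
  assumes t: "t > 0" and c: "c = real DIM('a) ^ 4 * 2 * sqrt (2 / pi)"
    and N: "\<And>m. N m > m" and C: "\<And>m. C m \<ge> 0"
    and wC: "\<And>m h x \<xi> n. h > 0 \<Longrightarrow> (\<And>k. k \<le> n \<Longrightarrow> chain h x \<xi> k \<in> cball 0 (real m)) \<Longrightarrow>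
       1 - weight h (real m) x \<xi> n \<le> (\<Sum>k<n. C m * (h * sqrt h + h ^ 3 + norm (\<xi> k) ^ 3))"
    and NC: "\<And>m. let h = t / real (N m) in
       real (N m) * (C m * (h * sqrt h + h ^ 3 + c * (h * sqrt h))) \<le> 1 / real (Suc m)"
    and W: "brownian_motion M W" and Y: "sde_solution M (\<lambda>y. - G y) \<sigma> t x W Y"
    and cont: "continuous_on UNIV f" and f: "\<And>z. 0 \<le> f z" "\<And>z. f z \<le> B"
  shows "(\<lambda>m. (kernel (t / real (N m)) (real m) ^^ N m) (\<lambda>z. ennreal (f z)) x)
    \<longlonglongrightarrow> (\<integral>\<^sup>+\<omega>. ennreal (f (Y t \<omega>)) \<partial>M)"
proof -
  interpret prob_space M using W by (simp add: brownian_motion_def)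
  have [measurable]: "f \<in> borel_measurable borel"
    using cont by (rule borel_measurable_continuous_onI)
  have B: "0 \<le> B" using f[of 0] by simp
  define h where "h m = t / real (N m)" for m
  have Npos: "N m > 0" for m using N[of m] by simp
  have h: "h m > 0" for m using t Npos[of m] by (simp add: h_def)
  define \<xi> where "\<xi> m \<omega> k = W (real (Suc k) * h m) \<omega> - W (real k * h m) \<omega>" for m \<omega> k
  define Z where "Z m \<omega> k = chain (h m) x (\<xi> m \<omega>) k" for m \<omega> k
  define wt where "wt m \<omega> = weight (h m) (real m) x (\<xi> m \<omega>) (N m)" for m \<omega>
  have W_measurable: "W s \<in> borel_measurable M" if "s \<ge> 0" for s
    using W that by (simp add: brownian_motion_def)
  have \<xi>_measurable [measurable]: "(\<lambda>\<omega>. \<xi> m \<omega> k) \<in> borel_measurable M" for m k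
    unfolding \<xi>_def using h[of m] by (intro borel_measurable_diff W_measurable) auto
  have Z_measurable [measurable]: "(\<lambda>\<omega>. Z m \<omega> k) \<in> borel_measurable M" for m k
    unfolding Z_def by (intro chain_measurable \<xi>_measurable)
  have wt_measurable [measurable]: "wt m \<in> borel_measurable M" for m
    unfolding wt_def[abs_def] by (intro weight_measurable \<xi>_measurable)
  have Y_measurable [measurable]: "Y t \<in> borel_measurable M"
    using Y t by (simp add: sde_solution_def)
  have wt: "0 \<le> wt m \<omega>" "wt m \<omega> \<le> 1" for m \<omega>
    by (simp_all add: wt_def weight_nonneg weight_le_1)
  have path: "AE \<omega> in M. (\<lambda>m. Z m \<omega> (N m)) \<longlonglongrightarrow> Y t \<omega> \<and>
      eventually (\<lambda>m. \<forall>k\<le>N m. Z m \<omega> k \<in> cball 0 (real m)) sequentially"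
  proof -
    have "AE \<omega> in M. W 0 \<omega> = 0" using W by (simp add: brownian_motion_def)
    moreover have "AE \<omega> in M. continuous_on {0..t} (\<lambda>s. Y s \<omega>) \<and>
        (\<forall>s\<in>{0..t}. ((\<lambda>r. - G (Y r \<omega>)) has_integral (Y s \<omega> - x - \<sigma> *\<^sub>R W s \<omega>)) {0..s})"
      using Y by (simp add: sde_solution_def)
    ultimately show ?thesis
    proof eventually_elim
      case (elim \<omega>)
      obtain r where r: "\<And>\<epsilon>. \<epsilon> > 0 \<Longrightarrow> \<exists>n0>0. \<forall>n\<ge>n0.
         (\<forall>k\<le>n. norm (chain (t / real n) x (\<lambda>k. W (real (Suc k) * (t / real n)) \<omega> - W (real k * (t / real n)) \<omega>) k) \<le> r) \<and>
         norm (chain (t / real n) x (\<lambda>k. W (real (Suc k) * (t / real n)) \<omega> - W (real k * (t / real n)) \<omega>) n - Y t \<omega>) \<le> \<epsilon>"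
        using euler_converges[of t "\<lambda>s. Y s \<omega>" "\<lambda>s. W s \<omega>" x] t elim by blast
      have Zr: "\<exists>n0. \<forall>m\<ge>n0. (\<forall>k\<le>N m. norm (Z m \<omega> k) \<le> r) \<and> norm (Z m \<omega> (N m) - Y t \<omega>) \<le> \<epsilon>"
        if eps: "\<epsilon> > 0" for \<epsilon>
      proof -
        obtain n0 where n0: "\<And>n. n \<ge> n0 \<Longrightarrow> (\<forall>k\<le>n. norm (chain (t / real n) x (\<lambda>k. W (real (Suc k) * (t / real n)) \<omega> - W (real k * (t / real n)) \<omega>) k) \<le> r) \<and>
         norm (chain (t / real n) x (\<lambda>k. W (real (Suc k) * (t / real n)) \<omega> - W (real k * (t / real n)) \<omega>) n - Y t \<omega>) \<le> \<epsilon>"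
          using r[OF eps] by blast
        have "(\<forall>k\<le>N m. norm (Z m \<omega> k) \<le> r) \<and> norm (Z m \<omega> (N m) - Y t \<omega>) \<le> \<epsilon>" if "m \<ge> n0" for m
          \<comment> \<open>From \<open>N m > m \<ge> n0\<close> the path bound for all large step
            numbers passes to the subsequence \<open>N\<close>.\<close>
          using n0[of "N m"] N[of m] that unfolding Z_def \<xi>_def h_def by simp
        then show ?thesis by blast
      qed
      have "(\<lambda>m. Z m \<omega> (N m)) \<longlonglongrightarrow> Y t \<omega>"
      proof (rule LIMSEQ_I)
        fix \<epsilon> :: real assume "\<epsilon> > 0"
        then obtain n0 where "\<forall>m\<ge>n0. norm (Z m \<omega> (N m) - Y t \<omega>) \<le> \<epsilon> / 2"
          using Zr[of "\<epsilon> / 2"] by auto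
        with \<open>\<epsilon> > 0\<close> show "\<exists>n0. \<forall>m\<ge>n0. norm (Z m \<omega> (N m) - Y t \<omega>) < \<epsilon>"
          by (intro exI[of _ n0]) force
      qed
      moreover have "eventually (\<lambda>m. \<forall>k\<le>N m. Z m \<omega> k \<in> cball 0 (real m)) sequentially"
      proof -
        obtain n0 where n0: "\<forall>m\<ge>n0. \<forall>k\<le>N m. norm (Z m \<omega> k) \<le> r"
          using Zr[of 1] by auto
        have "eventually (\<lambda>m. m \<ge> n0) sequentially" "eventually (\<lambda>m. m \<ge> nat \<lceil>r\<rceil>) sequentially"
          by (rule eventually_ge_at_top)+
        then show ?thesis
        proof eventually_elim
          case (elim m)
          then have "r \<le> real m" by linarith
          with n0 elim show ?case by force
        qed
      qed
      ultimately show ?case ..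
    qed
  qed
  \<comment> \<open>\<open>T\<close> is bounded and tends to 0 almost surely; \<open>E\<close> tends to 0 in mean only.\<close>
  define out where "out m \<omega> = (if \<forall>k\<in>{..N m}. norm (Z m \<omega> k) \<le> real m then 0 else 1 :: real)" for m \<omega>
  have out_measurable [measurable]: "out m \<in> borel_measurable M" for m
    unfolding out_def[abs_def] by measurable
  define T where "T m \<omega> = \<bar>f (Z m \<omega> (N m)) - f (Y t \<omega>)\<bar> + B * out m \<omega>" for m \<omega>
  define E where "E m \<omega> = (\<Sum>k<N m. C m * (h m * sqrt (h m) + h m ^ 3 + norm (\<xi> m \<omega> k) ^ 3))" for m \<omega>
  have T_measurable [measurable]: "T m \<in> borel_measurable M" for m
    unfolding T_def[abs_def] by measurable
  have T_bound: "norm (T m \<omega>) \<le> 2 * B" for m \<omega>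
  proof -
    have "\<bar>f (Z m \<omega> (N m)) - f (Y t \<omega>)\<bar> \<le> B"
      using f(1)[of "Z m \<omega> (N m)"] f(2)[of "Z m \<omega> (N m)"] f(1)[of "Y t \<omega>"] f(2)[of "Y t \<omega>"] by linarith
    then show ?thesis using B by (auto simp: T_def out_def)
  qed
  have T_int: "integrable M (T m)" for m
    by (rule integrable_const_bound[of _ "2 * B"]) (use T_bound in auto)
  have T_lim: "(\<lambda>m. LINT \<omega>|M. T m \<omega>) \<longlonglongrightarrow> (LINT \<omega>|M. 0)"
  proof (rule integral_dominated_convergence[where w = "\<lambda>_. 2 * B"])
    show "AE \<omega> in M. (\<lambda>m. T m \<omega>) \<longlonglongrightarrow> 0"
      using path
    proof eventually_elim
      case (elim \<omega>)
      have "isCont f (Y t \<omega>)" using cont by (simp add: continuous_on_eq_continuous_at)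
      from isCont_tendsto_compose[OF this elim[THEN conjunct1]]
      have "(\<lambda>m. f (Z m \<omega> (N m))) \<longlonglongrightarrow> f (Y t \<omega>)" .
      then have 1: "(\<lambda>m. \<bar>f (Z m \<omega> (N m)) - f (Y t \<omega>)\<bar>) \<longlonglongrightarrow> 0"
        by (intro tendsto_rabs_zero) (simp add: LIM_zero)
      have "eventually (\<lambda>m. B * out m \<omega> = 0) sequentially"
        using elim[THEN conjunct2] by eventually_elim (simp add: out_def)
      then have "(\<lambda>m. B * out m \<omega>) \<longlonglongrightarrow> 0" by (rule tendsto_eventually)
      from tendsto_add[OF 1 this] show ?case by (simp add: T_def)
    qed
  qed (use T_bound in auto)
  have E_int: "integrable M (E m)" for m
    unfolding E_def[abs_def] \<xi>_def
    by (intro Bochner_Integration.integrable_sum integrable_mult_right Bochner_Integration.integrable_add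
        integrable_const brownian_increment_cube(1)[OF W h])
  have E_le: "(LINT \<omega>|M. E m \<omega>) \<le> 1 / real (Suc m)" for m
  proof -
    have "(LINT \<omega>|M. E m \<omega>) = (\<Sum>k<N m. C m * (h m * sqrt (h m) + h m ^ 3 + (LINT \<omega>|M. norm (\<xi> m \<omega> k) ^ 3)))"
      unfolding E_def \<xi>_def
      by (simp add: brownian_increment_cube(1)[OF W h] Bochner_Integration.integral_sum prob_space
          del: of_nat_Suc)
    also have "\<dots> \<le> (\<Sum>k<N m. C m * (h m * sqrt (h m) + h m ^ 3 + c * (h m * sqrt (h m))))"
      using brownian_increment_cube(2)[OF W h] C unfolding \<xi>_def c
      by (intro sum_mono mult_left_mono add_left_mono) auto
    also have "\<dots> \<le> 1 / real (Suc m)"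
      using NC[of m] by (simp add: Let_def h_def)
    finally show ?thesis .
  qed
  have E_nonneg: "0 \<le> E m \<omega>" for m \<omega>
    unfolding E_def using C[of m] h[of m] by (intro sum_nonneg mult_nonneg_nonneg) auto
  \<comment> \<open>The defect bound is available only for paths that stay in the ball; on the
    others \<open>out\<close> equals 1 and the inequality is trivial.\<close>
  have wt_ge: "1 - wt m \<omega> \<le> out m \<omega> + E m \<omega>" for m \<omega>
  proof (cases "\<forall>k\<le>N m. Z m \<omega> k \<in> cball 0 (real m)")
    case True
    then have "1 - wt m \<omega> \<le> E m \<omega>"
      unfolding wt_def E_def Z_def by (intro wC h) auto
    then show ?thesis by (auto simp: out_def)
  next
    case False
    then have "out m \<omega> = 1" by (auto simp: out_def)
    then show ?thesis using wt(1)[of m \<omega>] E_nonneg[of m \<omega>] by simp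
  qed
  define e where "e m = (LINT \<omega>|M. wt m \<omega> * f (Z m \<omega> (N m)))" for m
  have wf: "0 \<le> wt m \<omega> * f (Z m \<omega> (N m))" "wt m \<omega> * f (Z m \<omega> (N m)) \<le> B" for m \<omega>
    using wt[of m \<omega>] f[of "Z m \<omega> (N m)"] mult_mono[of "wt m \<omega>" 1 "f (Z m \<omega> (N m))" B] by auto
  have wf_int: "integrable M (\<lambda>\<omega>. wt m \<omega> * f (Z m \<omega> (N m)))" for m
    by (rule integrable_const_bound[of _ B]) (use wf in auto)
  have fY_int: "integrable M (\<lambda>\<omega>. f (Y t \<omega>))"
    by (rule integrable_const_bound[of _ B]) (use f in auto)
  have e_bound: "\<bar>e m - (LINT \<omega>|M. f (Y t \<omega>))\<bar> \<le> (LINT \<omega>|M. T m \<omega>) + B * (1 / real (Suc m))" for m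
  proof -
    have "e m - (LINT \<omega>|M. f (Y t \<omega>)) = (LINT \<omega>|M. wt m \<omega> * f (Z m \<omega> (N m)) - f (Y t \<omega>))"
      unfolding e_def using wf_int fY_int by simp
    then have "\<bar>e m - (LINT \<omega>|M. f (Y t \<omega>))\<bar> \<le> (LINT \<omega>|M. \<bar>wt m \<omega> * f (Z m \<omega> (N m)) - f (Y t \<omega>)\<bar>)"
      by (simp add: integral_abs_bound)
    also have "\<dots> \<le> (LINT \<omega>|M. T m \<omega> + B * E m \<omega>)"
    proof (rule integral_mono)
      show "integrable M (\<lambda>\<omega>. \<bar>wt m \<omega> * f (Z m \<omega> (N m)) - f (Y t \<omega>)\<bar>)"
        using wf_int fY_int by simp
      show "integrable M (\<lambda>\<omega>. T m \<omega> + B * E m \<omega>)"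
        using T_int E_int by simp
      fix \<omega>
      let ?z = "f (Z m \<omega> (N m))"
      have "?z * (1 - wt m \<omega>) \<le> B * (out m \<omega> + E m \<omega>)"
        using wt_ge[of m \<omega>] wt(2)[of m \<omega>] f[of "Z m \<omega> (N m)"] B by (intro mult_mono) auto
      \<comment> \<open>The weighted value differs from the value at the end of the chain by the
        rejected mass, from which \<open>B * out\<close> goes into \<open>T\<close> and
        \<open>B * E\<close> is kept apart.\<close>
      moreover have "\<bar>wt m \<omega> * ?z - f (Y t \<omega>)\<bar> \<le> \<bar>?z - f (Y t \<omega>)\<bar> + ?z * (1 - wt m \<omega>)"
      proof -
        have "0 \<le> ?z * (1 - wt m \<omega>)" using f wt by simp
        moreover have "wt m \<omega> * ?z - f (Y t \<omega>) = (?z - f (Y t \<omega>)) - ?z * (1 - wt m \<omega>)"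
          by (simp add: algebra_simps)
        ultimately show ?thesis by linarith
      qed
      ultimately show "\<bar>wt m \<omega> * ?z - f (Y t \<omega>)\<bar> \<le> T m \<omega> + B * E m \<omega>"
        by (simp add: T_def distrib_left)
    qed
    also have "\<dots> = (LINT \<omega>|M. T m \<omega>) + B * (LINT \<omega>|M. E m \<omega>)"
      using T_int E_int by simp
    also have "\<dots> \<le> (LINT \<omega>|M. T m \<omega>) + B * (1 / real (Suc m))"
      using E_le[of m] B by (intro add_left_mono mult_left_mono)
    finally show ?thesis .
  qed
  have "(\<lambda>m. (LINT \<omega>|M. T m \<omega>) + B * (1 / real (Suc m))) \<longlonglongrightarrow> (LINT \<omega>|M. 0) + B * 0"
    by (intro tendsto_intros T_lim LIMSEQ_Suc[OF lim_1_over_n])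
  then have lim: "(\<lambda>m. (LINT \<omega>|M. T m \<omega>) + B * (1 / real (Suc m))) \<longlonglongrightarrow> 0"
    by simp
  have "(\<lambda>m. e m - (LINT \<omega>|M. f (Y t \<omega>))) \<longlonglongrightarrow> 0"
    by (rule Lim_null_comparison[OF always_eventually lim]) (simp only: real_norm_def e_bound simp_thms)
  then have "e \<longlonglongrightarrow> (LINT \<omega>|M. f (Y t \<omega>))"
    by (simp add: LIM_zero_iff)
  then have "(\<lambda>m. ennreal (e m)) \<longlonglongrightarrow> ennreal (LINT \<omega>|M. f (Y t \<omega>))"
    by (rule tendsto_ennrealI)
  moreover have "ennreal (LINT \<omega>|M. f (Y t \<omega>)) = (\<integral>\<^sup>+\<omega>. ennreal (f (Y t \<omega>)) \<partial>M)"
    using fY_int f(1) by (subst nn_integral_eq_integral) auto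
  moreover have "(kernel (t / real (N m)) (real m) ^^ N m) (\<lambda>z. ennreal (f z)) x = ennreal (e m)" for m
  proof -
    have "(kernel (h m) (real m) ^^ N m) (\<lambda>z. ennreal (f z)) x =
       (\<integral>\<^sup>+\<omega>. ennreal (wt m \<omega>) * ennreal (f (Z m \<omega> (N m))) \<partial>M)"
      unfolding wt_def Z_def \<xi>_def by (rule kernel_pow_eq_expectation[OF W h Npos]) measurable
    also have "\<dots> = (\<integral>\<^sup>+\<omega>. ennreal (wt m \<omega> * f (Z m \<omega> (N m))) \<partial>M)"
      using wt f by (simp add: ennreal_mult)
    also have "\<dots> = ennreal (e m)"
      unfolding e_def using wf_int wf(1) by (subst nn_integral_eq_integral) auto
    finally show ?thesis unfolding h_def .
  qed
  ultimately show ?thesis by simp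
qed

section \<open>Symmetry of the transition density\<close>

text \<open>The limit \<open>m \<rightarrow> \<infinity>\<close> of
  \<open>kernel_pow_symmetric\<close>. Compact support of the outer test function makes dominated
  convergence possible: \<open>stat\<close> is bounded there by continuity, whatever its global
  integrability.\<close>

lemma transition_density_symmetric_weak:
  fixes f g :: "'a \<Rightarrow> real"
  assumes t: "t > 0" and q: "sde_transition_density M (\<lambda>y. - G y) \<sigma> t q"
    and f: "continuous_on UNIV f" "\<And>z. 0 \<le> f z" "\<And>z. f z \<le> B" "\<And>z. z \<notin> cball 0 r \<Longrightarrow> f z = 0"
    and g: "continuous_on UNIV g" "\<And>z. 0 \<le> g z" "\<And>z. g z \<le> B" "\<And>z. z \<notin> cball 0 r \<Longrightarrow> g z = 0"
  shows "(\<integral>\<^sup>+x. ennreal (stat x) * (ennreal (f x) * (\<integral>\<^sup>+z. ennreal (q x z) * ennreal (g z) \<partial>lborel)) \<partial>lborel) =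
         (\<integral>\<^sup>+x. ennreal (stat x) * (ennreal (g x) * (\<integral>\<^sup>+z. ennreal (q x z) * ennreal (f z) \<partial>lborel)) \<partial>lborel)"
proof -
  define c where "c = real DIM('a) ^ 4 * 2 * sqrt (2 / pi)"
  have "0 \<le> c" by (simp add: c_def)
  from step_numbers[OF t this] obtain N C where N: "\<And>m. N m > m" and C: "\<And>m. C m \<ge> 0"
    and wC: "\<And>m h x \<xi> n. h > 0 \<Longrightarrow> (\<And>k. k \<le> n \<Longrightarrow> chain h x \<xi> k \<in> cball 0 (real m)) \<Longrightarrow>
       1 - weight h (real m) x \<xi> n \<le> (\<Sum>k<n. C m * (h * sqrt h + h ^ 3 + norm (\<xi> k) ^ 3))"
    and NC: "\<And>m. let h = t / real (N m) in
       real (N m) * (C m * (h * sqrt h + h ^ 3 + c * (h * sqrt h))) \<le> 1 / real (Suc m)"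
    by blast
  define K where "K m = kernel (t / real (N m)) (real m) ^^ N m" for m
  have h: "t / real (N m) > 0" for m
    using t N[of m] by simp
  \<comment> \<open>Stated for arbitrary \<open>f\<close> and \<open>g\<close>, since it is applied
    to both sides, with the roles exchanged.\<close>
  have lim: "(\<lambda>m. \<integral>\<^sup>+x. ennreal (stat x) * (ennreal (f x) * K m (\<lambda>z. ennreal (g z)) x) \<partial>lborel) \<longlonglongrightarrow>
      (\<integral>\<^sup>+x. ennreal (stat x) * (ennreal (f x) * (\<integral>\<^sup>+z. ennreal (q x z) * ennreal (g z) \<partial>lborel)) \<partial>lborel)"
    if f: "continuous_on UNIV f" "\<And>z. 0 \<le> f z" "\<And>z. z \<notin> cball 0 r \<Longrightarrow> f z = 0"
    and g: "continuous_on UNIV g" "\<And>z. 0 \<le> g z" "\<And>z. g z \<le> B" for f g :: "'a \<Rightarrow> real"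
  proof -
    have fm [measurable]: "f \<in> borel_measurable borel" and gm [measurable]: "g \<in> borel_measurable borel"
      using f(1) g(1) by (auto intro: borel_measurable_continuous_onI)
    have Km [measurable]: "K m (\<lambda>z. ennreal (g z)) \<in> borel_measurable borel" for m
      unfolding K_def by (rule kernel_pow_measurable) measurable
    have K_lim: "(\<lambda>m. K m (\<lambda>z. ennreal (g z)) x) \<longlonglongrightarrow> (\<integral>\<^sup>+z. ennreal (q x z) * ennreal (g z) \<partial>lborel)" for x
    proof -
      from q obtain W Y where W: "brownian_motion M W" and Y: "sde_solution M (\<lambda>y. - G y) \<sigma> t x W Y"
        and qm [measurable]: "q x \<in> borel_measurable borel"
        and law: "distr M borel (Y t) = density lborel (\<lambda>z. ennreal (q x z))"
        unfolding sde_transition_density_def by meson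
      have [measurable]: "Y t \<in> borel_measurable M"
        using Y t by (simp add: sde_solution_def)
      have "(\<integral>\<^sup>+\<omega>. ennreal (g (Y t \<omega>)) \<partial>M) = (\<integral>\<^sup>+z. ennreal (g z) \<partial>distr M borel (Y t))"
        by (subst nn_integral_distr) simp_all
      also have "\<dots> = (\<integral>\<^sup>+z. ennreal (q x z) * ennreal (g z) \<partial>lborel)"
        unfolding law by (subst nn_integral_density) simp_all
      finally show ?thesis
        using kernel_pow_tendsto[OF t c_def N C wC NC W Y g] by (simp add: K_def)
    qed
    have [measurable]: "cball (0::'a) r \<in> sets borel" by simp
    \<comment> \<open>\<open>sde_transition_density\<close> provides measurability of
      \<open>q x z\<close> in \<open>z\<close> only; measurability in \<open>x\<close> of the
      integral comes from its being a pointwise limit of kernel powers.\<close>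
    have lim_measurable: "(\<lambda>x. \<integral>\<^sup>+z. ennreal (q x z) * ennreal (g z) \<partial>lborel) \<in> borel_measurable borel"
      by (rule borel_measurable_LIMSEQ_order[OF K_lim Km])
    have "\<exists>D. \<forall>x\<in>cball 0 r. stat x * f x \<le> D"
    proof -
      have "continuous_on UNIV (\<lambda>x. stat x * f x)"
        unfolding stat_def using f(1) regular_potential_continuous(2)[OF potential] \<sigma>
        by (intro continuous_intros) auto
      then have "bounded ((\<lambda>x. stat x * f x) ` cball 0 r)"
        by (intro compact_imp_bounded compact_continuous_image) (auto intro: continuous_on_subset)
      then obtain D where "\<forall>x\<in>cball 0 r. norm (stat x * f x) \<le> D" unfolding bounded_iff by blast
      then show ?thesis by (intro exI[of _ D]) force
    qed
    then obtain D where D: "\<And>x. x \<in> cball 0 r \<Longrightarrow> stat x * f x \<le> D" by blast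
    show ?thesis
    proof (rule nn_integral_dominated_convergence[where w = "\<lambda>x. ennreal (D * B) * indicator (cball 0 r) x"])
      show "(\<lambda>x. ennreal (stat x) * (ennreal (f x) * (\<integral>\<^sup>+z. ennreal (q x z) * ennreal (g z) \<partial>lborel)))
          \<in> borel_measurable lborel"
        using lim_measurable by measurable
      show "(\<integral>\<^sup>+x. ennreal (D * B) * indicator (cball 0 r) x \<partial>lborel) < \<infinity>"
        by (simp add: nn_integral_cmult_indicator ennreal_mult_less_top emeasure_lborel_cball_finite[unfolded infinity_ennreal_def])
      show "AE x in lborel. ennreal (stat x) * (ennreal (f x) * K m (\<lambda>z. ennreal (g z)) x)
          \<le> ennreal (D * B) * indicator (cball 0 r) x" for m
      proof (rule AE_I2)
        fix x :: 'a
        show "ennreal (stat x) * (ennreal (f x) * K m (\<lambda>z. ennreal (g z)) x)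
          \<le> ennreal (D * B) * indicator (cball 0 r) x"
        proof (cases "x \<in> cball 0 r")
          case True
          have "K m (\<lambda>z. ennreal (g z)) x \<le> ennreal B"
            unfolding K_def using g by (intro kernel_pow_le h ennreal_leI) auto
          moreover have "ennreal (stat x * f x) \<le> ennreal D"
            using D[OF True] by (rule ennreal_leI)
          ultimately have "ennreal (stat x * f x) * K m (\<lambda>z. ennreal (g z)) x \<le> ennreal D * ennreal B"
            by (intro mult_mono) auto
          moreover have "0 \<le> D" using D[OF True] f(2)[of x] stat_pos[of x] by (smt (verit) mult_nonneg_nonneg)
          moreover have "0 \<le> B" using g(2,3)[of x] by linarith
          ultimately show ?thesis
            using True stat_pos[of x] f(2)[of x] by (simp add: ennreal_mult mult.assoc)
        qed (use f(3) in simp)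
      qed
      show "AE x in lborel. (\<lambda>m. ennreal (stat x) * (ennreal (f x) * K m (\<lambda>z. ennreal (g z)) x)) \<longlonglongrightarrow>
         ennreal (stat x) * (ennreal (f x) * (\<integral>\<^sup>+z. ennreal (q x z) * ennreal (g z) \<partial>lborel))"
        by (intro AE_I2 ennreal_tendsto_cmult K_lim ennreal_less_top)
    qed measurable
  qed
  have sym: "(\<integral>\<^sup>+x. ennreal (stat x) * (ennreal (f x) * K m (\<lambda>z. ennreal (g z)) x) \<partial>lborel) =
      (\<integral>\<^sup>+x. ennreal (stat x) * (ennreal (g x) * K m (\<lambda>z. ennreal (f z)) x) \<partial>lborel)" for m
    unfolding K_def using f(1) g(1)
    by (intro kernel_pow_symmetric h) (auto intro!: borel_measurable_continuous_onI measurable_compose[OF _ measurable_ennreal])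
  show ?thesis
    using LIMSEQ_unique[OF lim[OF f(1,2,4) g(1-3)] lim[OF g(1,2,4) f(1-3), folded sym]] .
qed

text \<open>A strict inequality at one pair \<open>(x, z)\<close> would by continuity persist on a
  product of balls, with two constants \<open>a < b\<close> in between, and localised test functions
  detect it. One inequality for all pairs suffices, since exchanging \<open>x\<close> and
  \<open>z\<close> gives the other.\<close>

lemma transition_density_symmetric:
  assumes t: "t > 0" and q: "sde_transition_density M (\<lambda>y. - G y) \<sigma> t q"
    and cont: "continuous_on UNIV (\<lambda>(x, z). q x z)"
  shows "stat x * q x z = stat z * q z x"
proof -
  have "stat x * q x z \<le> stat z * q z x" for x z
  proof (rule ccontr)
    assume "\<not> stat x * q x z \<le> stat z * q z x"
    then obtain a b where ab: "stat z * q z x < a" "a < b" "b < stat x * q x z"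
      by (metis dense not_le)
    have q0: "0 \<le> q x z" for x z
      using q by (simp add: sde_transition_density_def)
    have cont_stat: "continuous_on UNIV stat"
      unfolding stat_def using regular_potential_continuous(2)[OF potential] \<sigma>
      by (intro continuous_intros) auto
    define F where "F = (\<lambda>p. stat (fst p) * q (fst p) (snd p))"
    have cont_F: "continuous_on UNIV F"
      unfolding F_def using cont
      by (intro continuous_on_mult continuous_on_compose2[OF cont_stat] continuous_on_fst continuous_on_id)
         (auto simp: case_prod_beta')
    have cont_F': "continuous_on UNIV (\<lambda>p. F (snd p, fst p))"
      by (intro continuous_on_compose2[OF cont_F] continuous_intros) auto
    have "open {p. b < F p}" "open {p. F (snd p, fst p) < a}"
      using cont_F cont_F' by (auto intro!: open_Collect_less continuous_on_const)
    then have "open ({p. b < F p} \<inter> {p. F (snd p, fst p) < a})" by (rule open_Int)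
    moreover have "(x, z) \<in> {p. b < F p} \<inter> {p. F (snd p, fst p) < a}"
      using ab by (simp add: F_def)
    ultimately obtain \<epsilon> where \<epsilon>: "\<epsilon> > 0" "ball (x, z) \<epsilon> \<subseteq> {p. b < F p} \<inter> {p. F (snd p, fst p) < a}"
      by (rule openE)
    \<comment> \<open>Half of \<epsilon>, because the distance in the product is at most the sum of
      the two distances.\<close>
    define \<delta> where "\<delta> = \<epsilon> / 2"
    have \<delta>: "\<delta> > 0" using \<epsilon>(1) by (simp add: \<delta>_def)
    have box: "b < stat x' * q x' z'" "stat z' * q z' x' < a"
      if "dist x x' < \<delta>" "dist z z' < \<delta>" for x' z'
    proof -
      have "dist (x, z) (x', z') \<le> dist x x' + dist z z'"
        unfolding dist_prod_def by (simp add: sqrt_sum_squares_le_sum)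
      then have "(x', z') \<in> ball (x, z) \<epsilon>" using that by (simp add: \<delta>_def)
      then have "(x', z') \<in> {p. b < F p} \<inter> {p. F (snd p, fst p) < a}" using \<epsilon>(2) by blast
      then show "b < stat x' * q x' z'" "stat z' * q z' x' < a" by (simp_all add: F_def)
    qed
    \<comment> \<open>Testing the weak symmetry with bumps around \<open>x\<close> and \<open>z\<close> contradicts \<open>a < b\<close>.\<close>
    define bump where "bump = (\<lambda>c y :: 'a. max 0 (\<delta> - dist c y))"
    have bump_cont: "continuous_on UNIV (bump c)" for c
      unfolding bump_def by (intro continuous_intros)
    have bump_measurable [measurable]: "bump c \<in> borel_measurable borel" for c
      by (rule borel_measurable_continuous_onI[OF bump_cont])
    have bump: "0 \<le> bump c y" "bump c y \<le> \<delta>" "\<delta> \<le> dist c y \<Longrightarrow> bump c y = 0" for c y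
      using \<delta> by (auto simp: bump_def)
    define I where "I c = (\<integral>\<^sup>+y. ennreal (bump c y) \<partial>lborel)" for c
    have I_fin: "I c < \<infinity>" for c
    proof -
      have "I c \<le> (\<integral>\<^sup>+y. ennreal \<delta> * indicator (cball c \<delta>) y \<partial>lborel)"
        unfolding I_def using bump by (intro nn_integral_mono) (auto simp: indicator_def intro!: ennreal_leI)
      also have "\<dots> < \<infinity>"
        by (simp add: nn_integral_cmult_indicator ennreal_mult_less_top emeasure_lborel_cball_finite[unfolded infinity_ennreal_def])
      finally show ?thesis .
    qed
    have I_pos: "I c > 0" for c
    proof -
      have "0 < emeasure lborel (ball c (\<delta> / 2))"
        using \<delta> by (simp add: emeasure_ball)
      then have "0 < ennreal (\<delta> / 2) * emeasure lborel (ball c (\<delta> / 2))"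
        using \<delta> by (simp add: ennreal_zero_less_mult_iff)
      also have "\<dots> = (\<integral>\<^sup>+y. ennreal (\<delta> / 2) * indicator (ball c (\<delta> / 2)) y \<partial>lborel)"
        by (simp add: nn_integral_cmult_indicator)
      also have "\<dots> \<le> I c"
        unfolding I_def using \<delta>
        by (intro nn_integral_mono) (auto simp: indicator_def bump_def intro!: ennreal_leI)
      finally show ?thesis .
    qed
    define r where "r = norm x + norm z + \<delta>"
    have supp: "bump c y = 0" if "y \<notin> cball 0 r" "c = x \<or> c = z" for c y
    proof -
      have "norm y \<le> norm c + dist c y" by (metis dist_commute dist_norm norm_triangle_sub)
      moreover have "norm c \<le> norm x + norm z" using that(2) by auto
      ultimately have "\<delta> \<le> dist c y" using that(1) by (simp add: r_def)
      then show ?thesis by (rule bump(3))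
    qed
    have weak: "(\<integral>\<^sup>+y. ennreal (stat y) * (ennreal (bump x y) * (\<integral>\<^sup>+y'. ennreal (q y y') * ennreal (bump z y') \<partial>lborel)) \<partial>lborel) =
         (\<integral>\<^sup>+y. ennreal (stat y) * (ennreal (bump z y) * (\<integral>\<^sup>+y'. ennreal (q y y') * ennreal (bump x y') \<partial>lborel)) \<partial>lborel)"
      by (rule transition_density_symmetric_weak[OF t q bump_cont bump(1,2) supp bump_cont bump(1,2) supp]) auto
    have qm [measurable]: "q y \<in> borel_measurable borel" for y
      using q by (simp add: sde_transition_density_def)
    have inner: "ennreal (stat y) * (ennreal (bump c y) * (\<integral>\<^sup>+y'. ennreal (q y y') * ennreal (bump c' y') \<partial>lborel)) =
        (\<integral>\<^sup>+y'. ennreal (bump c y) * (ennreal (stat y * q y y') * ennreal (bump c' y')) \<partial>lborel)" for c c' y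
      using stat_pos[of y] q0
      by (subst nn_integral_cmult[symmetric], simp)+ (simp add: ennreal_mult mult_ac)
    have const: "(\<integral>\<^sup>+y. \<integral>\<^sup>+y'. ennreal (bump c y) * (ennreal s * ennreal (bump c' y')) \<partial>lborel \<partial>lborel) =
        ennreal s * (I c * I c')" for c c' s
      unfolding I_def by (simp add: nn_integral_cmult nn_integral_multc mult_ac)
    have a: "0 \<le> a" "0 \<le> b" using ab q0[of z x] stat_pos[of z] by (smt (verit) mult_nonneg_nonneg)+
    have "ennreal b * (I x * I z) \<le> (\<integral>\<^sup>+y. \<integral>\<^sup>+y'. ennreal (bump x y) * (ennreal (stat y * q y y') * ennreal (bump z y')) \<partial>lborel \<partial>lborel)"
      unfolding const[symmetric]
    proof (intro nn_integral_mono)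
      fix y y'
      show "ennreal (bump x y) * (ennreal b * ennreal (bump z y')) \<le>
        ennreal (bump x y) * (ennreal (stat y * q y y') * ennreal (bump z y'))"
      proof (cases "dist x y < \<delta> \<and> dist z y' < \<delta>")
        case True
        then show ?thesis
          using box(1)[of y y'] by (intro mult_left_mono mult_right_mono ennreal_leI) auto
      qed (use bump(3)[of x y] bump(3)[of z y'] in auto)
    qed
    also have "\<dots> = (\<integral>\<^sup>+y. \<integral>\<^sup>+y'. ennreal (bump z y) * (ennreal (stat y * q y y') * ennreal (bump x y')) \<partial>lborel \<partial>lborel)"
      using weak unfolding inner .
    also have "\<dots> \<le> ennreal a * (I z * I x)"
      unfolding const[symmetric]
    proof (intro nn_integral_mono)
      fix y y'
      show "ennreal (bump z y) * (ennreal (stat y * q y y') * ennreal (bump x y')) \<le>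
        ennreal (bump z y) * (ennreal a * ennreal (bump x y'))"
      proof (cases "dist x y' < \<delta> \<and> dist z y < \<delta>")
        case True
        then show ?thesis
          using box(2)[of y' y] by (intro mult_left_mono mult_right_mono ennreal_leI) auto
      qed (use bump(3)[of x y'] bump(3)[of z y] in auto)
    qed
    finally have le: "ennreal b * (I x * I z) \<le> ennreal a * (I x * I z)" by (simp add: mult.commute)
    \<comment> \<open>Positivity and finiteness are both needed to preserve the strict inequality
      under multiplication in \<open>ennreal\<close>.\<close>
    have "0 < I x * I z" "I x * I z < \<infinity>"
      using I_pos I_fin by (simp_all add: ennreal_zero_less_mult_iff ennreal_mult_less_top)
    moreover have "ennreal a < ennreal b" using ab a by (simp add: ennreal_less_iff)
    ultimately have "ennreal a * (I x * I z) < ennreal b * (I x * I z)"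
      by (intro ennreal_mult_strict_right_mono) auto
    with le show False by simp
  qed
  then show ?thesis by (intro antisym)
qed

end

subsection \<open>Detailed balance\<close>

text \<open>An ordered pair containing \<open>i\<close> has it in first or in second place according
  to the other index; symmetry of \<open>f\<close> merges the two kinds into one sum over
  \<open>j \<noteq> i\<close>.\<close>

lemma pair_sum_split:
  fixes f :: "nat \<Rightarrow> nat \<Rightarrow> real"
  assumes i: "i \<in> {1..N}" and sym: "\<And>a b. f a b = f b a"
  shows "(\<Sum>a=1..N. \<Sum>b\<in>{a<..N}. f a b) =
    (\<Sum>j\<in>{1..N} - {i}. f i j) + (\<Sum>a\<in>{1..N} - {i}. \<Sum>b\<in>{a<..N} - {i}. f a b)"
proof -
  have inner: "(\<Sum>b\<in>{a<..N}. f a b) = (if a < i then f i a else 0) + (\<Sum>b\<in>{a<..N} - {i}. f a b)" for a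
    using i sym[of a i] by (auto simp: sum.remove[of "{a<..N}" i])
  have "(\<Sum>a\<in>{1..N} - {i}. if a < i then f i a else 0) = (\<Sum>a\<in>{1..<i}. f i a)"
    using i by (subst sum.inter_filter[symmetric]) (auto intro!: sum.cong)
  moreover have "(\<Sum>j\<in>{1..N} - {i}. f i j) = (\<Sum>j\<in>{1..<i}. f i j) + (\<Sum>j\<in>{i<..N}. f i j)"
    using i by (subst sum.union_disjoint[symmetric]) (auto intro!: sum.cong)
  moreover have "(\<Sum>a=1..N. \<Sum>b\<in>{a<..N}. f a b) =
      (\<Sum>b\<in>{i<..N}. f i b) + (\<Sum>a\<in>{1..N} - {i}. \<Sum>b\<in>{a<..N}. f a b)"
    by (rule sum.remove[OF finite_atLeastAtMost i])
  moreover have "(\<Sum>a\<in>{1..N} - {i}. \<Sum>b\<in>{a<..N}. f a b) =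
      (\<Sum>a\<in>{1..N} - {i}. if a < i then f i a else 0) + (\<Sum>a\<in>{1..N} - {i}. \<Sum>b\<in>{a<..N} - {i}. f a b)"
    unfolding sum.distrib[symmetric] by (rule sum.cong[OF refl inner])
  ultimately show ?thesis by simp
qed

text \<open>The factor \<open>r\<close> collects everything that does not involve particle
  \<open>i\<close>. Only its independence of \<open>z\<close> matters for ratios of weights, so it
  stays anonymous.\<close>

lemma gibbs_weight_update:
  assumes i: "i \<in> {1..N}" and even: "\<And>x. U (- x) = U x"
  obtains r where "\<And>z. gibbs_weight N w \<beta> V U (X(i := z)) =
    r * exp (- \<beta> * (w * V z + (\<Sum>j\<in>{1..N} - {i}. w\<^sup>2 * U (z - X j))))"
proof -
  define s where "s = (\<Sum>a\<in>{1..N} - {i}. w * V (X a)) +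
    (\<Sum>a\<in>{1..N} - {i}. \<Sum>b\<in>{a<..N} - {i}. w\<^sup>2 * U (X a - X b))"
  have "gibbs_weight N w \<beta> V U (X(i := z)) =
    exp (- \<beta> * s) * exp (- \<beta> * (w * V z + (\<Sum>j\<in>{1..N} - {i}. w\<^sup>2 * U (z - X j))))" for z
  proof -
    let ?Y = "X(i := z)"
    have sym: "w\<^sup>2 * U (?Y a - ?Y b) = w\<^sup>2 * U (?Y b - ?Y a)" for a b
      using even[of "?Y a - ?Y b"] by simp
    have 1: "(\<Sum>a=1..N. w * V (?Y a)) = w * V z + (\<Sum>a\<in>{1..N} - {i}. w * V (X a))"
      unfolding sum.remove[OF finite_atLeastAtMost i]
      by (intro arg_cong2[where f = "(+)"] sum.cong) auto
    have 2: "(\<Sum>a=1..N. \<Sum>b\<in>{a<..N}. w\<^sup>2 * U (?Y a - ?Y b)) =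
      (\<Sum>j\<in>{1..N} - {i}. w\<^sup>2 * U (z - X j)) +
      (\<Sum>a\<in>{1..N} - {i}. \<Sum>b\<in>{a<..N} - {i}. w\<^sup>2 * U (X a - X b))"
      by (subst pair_sum_split[OF i sym]) (intro arg_cong2[where f = "(+)"] sum.cong; auto)
    show ?thesis
      unfolding gibbs_weight_def 1 2 s_def exp_add[symmetric] by (simp add: algebra_simps)
  qed
  then show ?thesis by (rule that)
qed

text \<open>The drift is minus the gradient of \<open>(V / w + \<Sum> U\<^sub>1) / (N - 1)\<close>
  and the squared noise is \<open>2 / ((N - 1) * w\<^sup>2 * \<beta>)\<close>. Twice the potential
  divided by the squared noise is therefore \<beta> times
  \<open>w * V + w\<^sup>2 * \<Sum> U\<^sub>1\<close>, so \<open>stat\<close> is the conditional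
  Gibbs factor of particle \<open>i\<close> without \<open>U\<^sub>2\<close>.\<close>

lemma sde_density_detailed_balance:
  fixes V U\<^sub>1 :: "'a::euclidean_space \<Rightarrow> real"
  assumes N: "N \<ge> 2" and w: "w > 0" and \<beta>: "\<beta> > 0" and t: "t > 0" and V: "smooth V" and U\<^sub>1: "smooth U\<^sub>1"
    and q: "sde_transition_density M (drift N w V U\<^sub>1 i X) (noise N w \<beta>) t q"
    and cont: "continuous_on UNIV (\<lambda>(x, z). q x z)"
  shows "exp (- \<beta> * (w * V x + (\<Sum>j\<in>{1..N} - {i}. w\<^sup>2 * U\<^sub>1 (x - X j)))) * q x z =
         exp (- \<beta> * (w * V z + (\<Sum>j\<in>{1..N} - {i}. w\<^sup>2 * U\<^sub>1 (z - X j)))) * q z x"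
proof -
  define \<Phi> where "\<Phi> = (\<lambda>y. 1 / (w * (real N - 1)) * V y +
    1 / (real N - 1) * (\<Sum>j\<in>{1..N} - {i}. U\<^sub>1 (y - X j)))"
  define G where "G = (\<lambda>y. (1 / (w * (real N - 1))) *\<^sub>R gradient V y +
    (1 / (real N - 1)) *\<^sub>R (\<Sum>j\<in>{1..N} - {i}. gradient U\<^sub>1 (y - X j)))"
  let ?\<sigma> = "noise N w \<beta>"
  have "?\<sigma> > 0" using N w \<beta> by (simp add: noise_def)
  moreover have "regular_potential \<Phi> G"
    unfolding \<Phi>_def G_def using V U\<^sub>1
    by (intro regular_potential_add regular_potential_scale regular_potential_sum
        regular_potential_translate smooth_imp_regular_potential) auto
  ultimately interpret langevin \<Phi> G ?\<sigma> by unfold_locales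
  have \<sigma>2: "?\<sigma>\<^sup>2 = 2 / ((real N - 1) * w\<^sup>2 * \<beta>)"
    using N w \<beta> by (simp add: noise_def)
  have stat: "stat y = exp (- \<beta> * (w * V y + (\<Sum>j\<in>{1..N} - {i}. w\<^sup>2 * U\<^sub>1 (y - X j))))" for y
  proof -
    have "- 2 * \<Phi> y / ?\<sigma>\<^sup>2 = - \<beta> * (w * V y + w\<^sup>2 * (\<Sum>j\<in>{1..N} - {i}. U\<^sub>1 (y - X j)))"
    proof -
      have "- 2 * (1 / (w * n) * v + 1 / n * s) / (2 / (n * w\<^sup>2 * \<beta>)) = - \<beta> * (w * v + w\<^sup>2 * s)"
        if "n > 0" for n v s
        using that w \<beta> by (simp add: field_simps power2_eq_square)
      from this[of "real N - 1"] show ?thesis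
        unfolding \<sigma>2 \<Phi>_def using N by simp
    qed
    then show ?thesis by (simp add: stat_def sum_distrib_left)
  qed
  have "drift N w V U\<^sub>1 i X = (\<lambda>y. - G y)"
    by (simp add: drift_def[abs_def] G_def)
  with q have "sde_transition_density M (\<lambda>y. - G y) ?\<sigma> t q" by simp
  from transition_density_symmetric[OF t this cont] show ?thesis
    unfolding stat .
qed

theorem theorem2p1:
  fixes N :: nat and w \<beta> t :: real
    and V U U\<^sub>1 U\<^sub>2 :: "real ^ 'd \<Rightarrow> real"
    and u u\<^sub>1 u\<^sub>2 :: "real \<Rightarrow> real"
    and M :: "'w measure"
    and p :: "nat \<Rightarrow> (nat \<Rightarrow> real ^ 'd) \<Rightarrow> real ^ 'd \<Rightarrow> real"
    and X X' :: "nat \<Rightarrow> real ^ 'd"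
  assumes "N \<ge> 2" and "w > 0" and "\<beta> > 0" and "t > 0"
    and "smooth V"
    and "\<And>x. U x = u (norm x)" and "\<And>x. U\<^sub>1 x = u\<^sub>1 (norm x)" and "\<And>x. U\<^sub>2 x = u\<^sub>2 (norm x)"
    and "\<And>x. U x = U\<^sub>1 x + U\<^sub>2 x"
    and "smooth U\<^sub>1" and "bounded (range U\<^sub>1)"
    and "U\<^sub>2 \<in> borel_measurable borel" and "compact (closure {x. U\<^sub>2 x \<noteq> 0})"
    and "normalizable N w \<beta> V U"
    and "\<And>i Y. i \<in> {1..N} \<Longrightarrow> Y \<in> configs N \<Longrightarrow>
           sde_transition_density M (drift N w V U\<^sub>1 i Y) (noise N w \<beta>) t (\<lambda>x z. p i (Y(i := x)) z)"
    and "\<And>i Y. i \<in> {1..N} \<Longrightarrow> Y \<in> configs N \<Longrightarrow>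
           continuous_on UNIV (\<lambda>(x, z). p i (Y(i := x)) z)"
    and "X \<in> states N U" and "X' \<in> states N U"
  shows "gibbs_density N w \<beta> V U X * transition N w \<beta> U\<^sub>2 p X X' =
         gibbs_density N w \<beta> V U X' * transition N w \<beta> U\<^sub>2 p X' X"
proof -
  note N = assms(1) and t = assms(4) and V = assms(5) and U_radial = assms(6) and U\<^sub>1 = assms(10)
    and q = assms(15) and cont = assms(16)
  have X: "X \<in> configs N" and X': "X' \<in> configs N"
    using assms(17,18) by (auto simp: states_def)
  define D where "D = {i \<in> {1..N}. X i \<noteq> X' i}"
  have D_eq: "{i \<in> {1..N}. X i \<noteq> X' i} = D" "{i \<in> {1..N}. X' i \<noteq> X i} = D"
    by (auto simp: D_def)
  show ?thesis
  proof (cases "\<exists>i. D = {i}")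
    case False
    show ?thesis
    proof (cases "D = {}")
      case True
      have "X = X'"
      proof
        fix k show "X k = X' k"
          using True X X' by (cases "k \<in> {1..N}") (auto simp: D_def PiE_def extensional_def)
      qed
      then show ?thesis by simp
    next
      case nonempty: False
      have "transition N w \<beta> U\<^sub>2 p X X' = 0" "transition N w \<beta> U\<^sub>2 p X' X = 0"
        using False nonempty unfolding transition_def Let_def D_eq by simp_all
      then show ?thesis by simp
    qed
  next
    case True
    then obtain i where D: "D = {i}" ..
    then have i: "i \<in> {1..N}" by (auto simp: D_def)
    define x z where "x = X i" and "z = X' i"
    have Xx: "X = X(i := x)" by (simp add: x_def)
    have Xz: "X' = X(i := z)"
    proof
      fix k show "X' k = (X(i := z)) k"
        using D X X' by (cases "k \<in> {1..N}") (auto simp: z_def D_def PiE_def extensional_def)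
    qed
    let ?J = "{1..N} - {i}"
    \<comment> \<open>The splitting of \<open>U\<close> splits the conditional weight:
      \<open>B\<close> is balanced by the proposal, \<open>A\<close> by the acceptance step.\<close>
    define A where "A y = exp (- \<beta> * (\<Sum>j\<in>?J. w\<^sup>2 * U\<^sub>2 (y - X j)))" for y
    define B where "B y = exp (- \<beta> * (w * V y + (\<Sum>j\<in>?J. w\<^sup>2 * U\<^sub>1 (y - X j))))" for y
    have A: "A y > 0" for y by (simp add: A_def)
    have balance: "B x * p i X z = B z * p i X' x"
      using sde_density_detailed_balance[OF N assms(2,3) t V U\<^sub>1 q[OF i X] cont[OF i X], of x z]
      by (simp add: B_def Xx[symmetric] Xz[symmetric])
    have "U (- y) = U y" for y by (simp add: U_radial)
    then obtain r where r: "\<And>y. gibbs_weight N w \<beta> V U (X(i := y)) =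
        r * exp (- \<beta> * (w * V y + (\<Sum>j\<in>?J. w\<^sup>2 * U (y - X j))))"
      using gibbs_weight_update[OF i] by blast
    have weight: "gibbs_weight N w \<beta> V U (X(i := y)) = r * (B y * A y)" for y
      unfolding r A_def B_def exp_add[symmetric]
      by (simp add: assms(9) distrib_left sum.distrib algebra_simps)
    \<comment> \<open>Formulated for an update of \<open>X\<close>, so that it covers the move from
      \<open>X\<close> and the reverse move from \<open>X'\<close> alike.\<close>
    have acc_ratio: "acc N w \<beta> U\<^sub>2 i Y y = min 1 (A y / A y')"
      if "Y = X(i := y')" for Y y y'
    proof -
      have eq: "(\<Sum>j\<in>?J. w\<^sup>2 * (U\<^sub>2 (y - Y j) - U\<^sub>2 (Y i - Y j))) =
        (\<Sum>j\<in>?J. w\<^sup>2 * U\<^sub>2 (y - X j)) - (\<Sum>j\<in>?J. w\<^sup>2 * U\<^sub>2 (y' - X j))"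
        unfolding sum_subtractf[symmetric] that by (intro sum.cong) (auto simp: right_diff_distrib)
      show ?thesis
        unfolding acc_def eq A_def exp_diff[symmetric] by (simp only: right_diff_distrib)
    qed
    \<comment> \<open>The Metropolis identity again: both products are the symmetric quantity
      \<open>min (A x) (A z)\<close>.\<close>
    have "A x * min 1 (A z / A x) = min (A x) (A z)" "A z * min 1 (A x / A z) = min (A x) (A z)"
      using A[of x] A[of z] by (auto simp: min_def field_simps)
    then have accept: "A x * acc N w \<beta> U\<^sub>2 i X z = A z * acc N w \<beta> U\<^sub>2 i X' x"
      using acc_ratio[OF Xx] acc_ratio[OF Xz] by simp
    let ?Z = "LINT Y|Pi\<^sub>M {1..N} (\<lambda>_. lborel). gibbs_weight N w \<beta> V U Y"
    have "gibbs_weight N w \<beta> V U X = r * (B x * A x)" "gibbs_weight N w \<beta> V U X' = r * (B z * A z)"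
      using weight[of x] weight[of z] by (simp_all add: Xx[symmetric] Xz[symmetric])
    moreover have "transition N w \<beta> U\<^sub>2 p X X' = 1 / real N * p i X z * acc N w \<beta> U\<^sub>2 i X z"
      "transition N w \<beta> U\<^sub>2 p X' X = 1 / real N * p i X' x * acc N w \<beta> U\<^sub>2 i X' x"
      unfolding transition_def Let_def D_eq D by (simp_all add: x_def z_def)
    moreover have "(r * (B x * A x) / ?Z) * (1 / real N * p i X z * acc N w \<beta> U\<^sub>2 i X z) =
        r / ?Z / real N * (B x * p i X z) * (A x * acc N w \<beta> U\<^sub>2 i X z)"
      by simp
    moreover have "(r * (B z * A z) / ?Z) * (1 / real N * p i X' x * acc N w \<beta> U\<^sub>2 i X' x) =
        r / ?Z / real N * (B z * p i X' x) * (A z * acc N w \<beta> U\<^sub>2 i X' x)"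
      by simp
    ultimately show ?thesis
      unfolding gibbs_density_def by (simp only: balance accept)
  qed
qed

end
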